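(* Let $n,\ell\ge 1$ be integers, let $\sigma_x,\sigma_n,\sigma_w>0$ and $\sigma_b\ge 0$, and let $\phi:\mathbb{R}\to\mathbb{R}$ be a measurable activation function. Consider the random noisy feed-forward neural network with Gaussian input $\mathbf{X}\sim\mathcal{N}(\mathbf{0},\sigma_x^2\mathbf{I})$ in $\mathbb{R}^n$ and hidden layers $\mathbf{h}^{(1)},\dots,\mathbf{h}^{(\ell)}$ defined in the context. Let $\mathcal{W}^{:\ell}$ be its random weights and biases up to layer $\ell$. Conditionally on $\mathcal{W}^{:\ell}$, let $\bm{\Lambda}_{h^{(\ell)}}$ be the $n\times n$ covariance matrix of $\mathbf{h}^{(\ell)}$ and let $\bm{\Sigma}_{xh^{(\ell)}}$ be the $n\times n$ cross-covariance matrix of $\mathbf{X}$ and $\mathbf{h}^{(\ell)}$. Assume that, for almost every $\mathcal{W}^{:\ell}$, the conditional second moments of $\mathbf{h}^{(\ell)}$ are finite, and that the two expectations on the right-hand side below are finite. Then $$I(\mathbf{X},\mathbf{h}^{(\ell)})\ \geq\ \frac12\,\mathbb{E}_{\mathcal{W}^{:\ell}}\left[\log\left|\bm{\Lambda}_{h^{(\ell)}}\right|\right]-\mathbb{E}_{\mathcal{W}^{:\ell}}\left[\frac12\log\left|\bm{\Lambda}_{h^{(\ell)}}-\frac{1}{\sigma_x^2}\bm{\Sigma}_{xh^{(\ell)}}^\top\bm{\Sigma}_{xh^{(\ell)}}\right|\right],$$ where $|\cdot|$ denotes the determinant and $I(\mathbf{X},\mathbf{h}^{(\ell)})$ is the weight-averaged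 mutual information defined in the context.
   Context: Network: $\mathbf{h}^{(1)}=\mathbf{W}^{(1)}\mathbf{X}+\mathbf{b}^{(1)}+\mathbf{n}^{(1)}$ and, for $2\le i\le \ell$, $\mathbf{h}^{(i)}=\mathbf{W}^{(i)}\phi(\mathbf{h}^{(i-1)})+\mathbf{b}^{(i)}+\mathbf{n}^{(i)}$, where $\phi$ is applied entrywise, $\mathbf{W}^{(i)}\in\mathbb{R}^{n\times n}$ has i.i.d. entries $\mathcal{N}(0,\sigma_w^2/n)$, $\mathbf{b}^{(i)}\in\mathbb{R}^n$ has i.i.d. entries $\mathcal{N}(0,\sigma_b^2)$, and the noise $\mathbf{n}^{(i)}\in\mathbb{R}^n$ has i.i.d. entries $\mathcal{N}(0,\sigma_n^2)$. The input $\mathbf{X}$ and all the $\mathbf{W}^{(i)},\mathbf{b}^{(i)},\mathbf{n}^{(i)}$ are mutually independent. Put $\mathcal{W}^{:\ell}=\{\mathbf{W}^{(i)},\mathbf{b}^{(i)}\}_{i=1}^{\ell}$. Conditional moments: with $\mathcal{W}^{:\ell}$ fixed and expectations over $\mathbf{X}$ and the noises, the covariance matrix of the stacked vector $(\mathbf{X}^\top,\mathbf{h}^{(\ell)\top})^\top$ is $$\begin{bmatrix}\sigma_x^2\mathbf{I} & \bm{\Sigma}_{xh^{(\ell)}}\\ \bm{\Sigma}_{xh^{(\ell)}}^\top & \bm{\Lambda}_{h^{(\ell)}}\end{bmatrix}.$$ Mutual information: for a pair of random vectors with joint density $p_{X,Y}$ and marginals $p_X,p_Y$, $I(X,Y)=\int\int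 p_{X,Y}(x,y)\log\frac{p_{X,Y}(x,y)}{p_X(x)p_Y(y)}\,dx\,dy\in[0,\infty]$. $I(\mathbf{X},\mathbf{h}^{(\ell)}\mid\mathcal{W}^{:\ell})$ denotes the mutual information of $\mathbf{X}$ and $\mathbf{h}^{(\ell)}$ under their joint law with the weights and biases $\mathcal{W}^{:\ell}$ held fixed, and the network mutual information is by definition its average over weights, $$I(\mathbf{X},\mathbf{h}^{(\ell)}):=\mathbb{E}_{\mathcal{W}^{:\ell}}\left[I(\mathbf{X},\mathbf{h}^{(\ell)}\mid\mathcal{W}^{:\ell})\right].$$ *)

theory Defs
  imports "HOL-Probability.Probability"
begin

(* Integral of an extended-real function as the difference of the integrals of its positive and
   negative parts, so that it may take infinite values. It is meaningful when the negative part has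
   finite integral (on ereal, \<infinity> - \<infinity> = \<infinity>). This always holds below: in the integrand of the mutual
   information, p ln (p/q) \<ge> p - q almost everywhere with \<integral>q = 1; and mutual information itself
   is nonnegative. *)
definition quasi_integral :: "'a measure \<Rightarrow> ('a \<Rightarrow> ereal) \<Rightarrow> ereal" where
  "quasi_integral M f =
     enn2ereal (\<integral>\<^sup>+x. e2ennreal (f x) \<partial>M) - enn2ereal (\<integral>\<^sup>+x. e2ennreal (- f x) \<partial>M)"

definition density_of :: "'a measure \<Rightarrow> 'b measure \<Rightarrow> ('a \<Rightarrow> 'b) \<Rightarrow> 'b \<Rightarrow> real" where
  "density_of M S X x = enn2real (RN_deriv S (distr M S X) x)"

(* Mutual information, in nats, of random vectors with a joint Lebesgue density. The library's
   mutual_information is a real-valued Bochner integral, which is 0 when the value is infinite. *)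
definition mutual_info ::
  "'a measure \<Rightarrow> ('a \<Rightarrow> 'b::euclidean_space) \<Rightarrow> ('a \<Rightarrow> 'c::euclidean_space) \<Rightarrow> ereal" where
  "mutual_info M X Y =
     quasi_integral (lborel \<Otimes>\<^sub>M lborel)
       (\<lambda>(x, y). let p = density_of M (lborel \<Otimes>\<^sub>M lborel) (\<lambda>\<omega>. (X \<omega>, Y \<omega>)) (x, y) in
          ereal (p * ln (p / (density_of M lborel X x * density_of M lborel Y y))))"

lemma density_of_AE_eq:
  assumes "prob_space M" "distributed M S X p"
  shows "AE x in S. density_of M S X x = enn2real (p x)"
  using prob_space.distributed_RN_deriv[OF assms]
  by eventually_elim (simp add: density_of_def distributed_distr_eq_density[OF assms(2)])

(* The value does not depend on the versions of the densities. *)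
lemma mutual_info_distributed:
  fixes X :: "'a \<Rightarrow> 'b::euclidean_space" and Y :: "'a \<Rightarrow> 'c::euclidean_space"
  assumes M: "prob_space M"
    and p: "distributed M (lborel \<Otimes>\<^sub>M lborel) (\<lambda>\<omega>. (X \<omega>, Y \<omega>)) (\<lambda>z. ennreal (p z))" "\<And>z. 0 \<le> p z"
    and q: "distributed M lborel X (\<lambda>x. ennreal (q x))" "\<And>x. 0 \<le> q x"
    and r: "distributed M lborel Y (\<lambda>y. ennreal (r y))" "\<And>y. 0 \<le> r y"
  shows "mutual_info M X Y =
    quasi_integral (lborel \<Otimes>\<^sub>M lborel) (\<lambda>(x, y). ereal (p (x, y) * ln (p (x, y) / (q x * r y))))"
proof -
  have 1: "AE z in lborel \<Otimes>\<^sub>M lborel.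
      density_of M (lborel \<Otimes>\<^sub>M lborel) (\<lambda>\<omega>. (X \<omega>, Y \<omega>)) z = p z"
    using density_of_AE_eq[OF M p(1)] p(2) by simp
  have [measurable]: "q \<in> borel_measurable borel" "r \<in> borel_measurable borel"
    using distributed_real_measurable[OF q(2) q(1)] distributed_real_measurable[OF r(2) r(1)] by auto
  have qm: "{z \<in> space (lborel \<Otimes>\<^sub>M (lborel :: 'c measure)). density_of M lborel X (fst z) = q (fst z)}
      \<in> sets (lborel \<Otimes>\<^sub>M lborel)"
    unfolding density_of_def by measurable
  have rm: "{z \<in> space ((lborel :: 'b measure) \<Otimes>\<^sub>M lborel). density_of M lborel Y (snd z) = r (snd z)}
      \<in> sets (lborel \<Otimes>\<^sub>M lborel)"
    unfolding density_of_def by measurable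
  have "AE x in lborel. density_of M lborel X x = q x"
    using density_of_AE_eq[OF M q(1)] q(2) by simp
  then have 2: "AE z in lborel \<Otimes>\<^sub>M (lborel :: 'c measure). density_of M lborel X (fst z) = q (fst z)"
    by (intro lborel_pair.AE_pair_measure[OF qm]) (auto elim!: eventually_mono)
  have "AE y in lborel. density_of M lborel Y y = r y"
    using density_of_AE_eq[OF M r(1)] r(2) by simp
  then have 3: "AE z in (lborel :: 'b measure) \<Otimes>\<^sub>M lborel. density_of M lborel Y (snd z) = r (snd z)"
    by (intro lborel_pair.AE_pair_measure[OF rm]) simp
  have 4: "AE z in lborel \<Otimes>\<^sub>M lborel.
     (case z of (x, y) \<Rightarrow> let d = density_of M (lborel \<Otimes>\<^sub>M lborel) (\<lambda>\<omega>. (X \<omega>, Y \<omega>)) (x, y) in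
          ereal (d * ln (d / (density_of M lborel X x * density_of M lborel Y y)))) =
     (case z of (x, y) \<Rightarrow> ereal (p (x, y) * ln (p (x, y) / (q x * r y))))"
    using 1 2 3 by eventually_elim (auto simp: Let_def split: prod.splits)
  show ?thesis
    unfolding mutual_info_def quasi_integral_def
    by (intro arg_cong2[where f = minus] arg_cong[where f = enn2ereal] nn_integral_cong_AE)
       (use 4 in eventually_elim, simp)+
qed

(* N(0, v) on the real line; the point mass at 0 when v = 0 *)
definition centered_normal :: "real \<Rightarrow> real measure" where
  "centered_normal v =
     (if v = 0 then return borel 0 else density lborel (\<lambda>x. ennreal (normal_density 0 (sqrt v) x)))"

(* density of N(0, v I), v > 0 *)
definition isotropic_normal_density :: "real \<Rightarrow> 'b::euclidean_space \<Rightarrow> real" where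
  "isotropic_normal_density v x = exp (- (norm x)\<^sup>2 / (2 * v)) / sqrt (2 * pi * v) ^ DIM('b)"

definition iid_normal :: "'a measure \<Rightarrow> real \<Rightarrow> ('i \<Rightarrow> 'a \<Rightarrow> real) \<Rightarrow> bool" where
  "iid_normal M v Z \<longleftrightarrow>
     prob_space.indep_vars M (\<lambda>_. borel) Z UNIV \<and> (\<forall>i. distr M borel (Z i) = centered_normal v)"

datatype source = Input | Weight nat | Bias nat | Noise nat

definition generated_events :: "'a measure \<Rightarrow> ('a \<Rightarrow> 'b::topological_space) \<Rightarrow> 'a set set" where
  "generated_events M Z = {Z -` A \<inter> space M | A. A \<in> sets borel}"

(* The variables have different types, so independence is stated on the sigma-algebras they
   generate. *)
definition mutually_independent ::
  "'a measure \<Rightarrow> nat \<Rightarrow> ('a \<Rightarrow> real^'n) \<Rightarrow> (nat \<Rightarrow> 'a \<Rightarrow> real^'n^'n) \<Rightarrow>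
   (nat \<Rightarrow> 'a \<Rightarrow> real^'n) \<Rightarrow> (nat \<Rightarrow> 'a \<Rightarrow> real^'n) \<Rightarrow> bool" where
  "mutually_independent M l X W b N \<longleftrightarrow>
     prob_space.indep_sets M
       (\<lambda>s. case s of
          Input \<Rightarrow> generated_events M X
        | Weight i \<Rightarrow> generated_events M (W i)
        | Bias i \<Rightarrow> generated_events M (b i)
        | Noise i \<Rightarrow> generated_events M (N i))
       ({Input} \<union> Weight ` {1..l} \<union> Bias ` {1..l} \<union> Noise ` {1..l})"

(* Layer i as a function of the weights, biases, input and noises. Layers are numbered from 1; the
   value at 0 is a dummy. *)
fun hidden ::
  "(real \<Rightarrow> real) \<Rightarrow> (nat \<Rightarrow> real^'n^'n) \<Rightarrow> (nat \<Rightarrow> real^'n) \<Rightarrow> real^'n \<Rightarrow> (nat \<Rightarrow> real^'n) \<Rightarrow>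
   nat \<Rightarrow> real^'n" where
  "hidden \<phi> w b x \<nu> 0 = 0"
| "hidden \<phi> w b x \<nu> (Suc 0) = w 1 *v x + b 1 + \<nu> 1"
| "hidden \<phi> w b x \<nu> (Suc (Suc i)) =
     w (Suc (Suc i)) *v (\<chi> j. \<phi> (hidden \<phi> w b x \<nu> (Suc i) $ j)) + b (Suc (Suc i)) + \<nu> (Suc (Suc i))"

definition cross_cov :: "'a measure \<Rightarrow> ('a \<Rightarrow> real^'m) \<Rightarrow> ('a \<Rightarrow> real^'n) \<Rightarrow> real^'n^'m" where
  "cross_cov M X Y =
     (\<chi> i j. \<integral>\<omega>. (X \<omega> $ i - (\<integral>\<omega>'. X \<omega>' $ i \<partial>M)) * (Y \<omega> $ j - (\<integral>\<omega>'. Y \<omega>' $ j \<partial>M)) \<partial>M)"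

(* The last layer with the weights and biases frozen at w, b: only the input and the noises remain
   random. *)
definition frozen ::
  "(real \<Rightarrow> real) \<Rightarrow> nat \<Rightarrow> ('a \<Rightarrow> real^'n) \<Rightarrow> (nat \<Rightarrow> 'a \<Rightarrow> real^'n) \<Rightarrow>
   (nat \<Rightarrow> real^'n^'n) \<Rightarrow> (nat \<Rightarrow> real^'n) \<Rightarrow> 'a \<Rightarrow> real^'n" where
  "frozen \<phi> l X N w b \<omega> = hidden \<phi> w b (X \<omega>) (\<lambda>i. N i \<omega>) l"

definition cond_Lambda ::
  "'a measure \<Rightarrow> (real \<Rightarrow> real) \<Rightarrow> nat \<Rightarrow> ('a \<Rightarrow> real^'n) \<Rightarrow> (nat \<Rightarrow> 'a \<Rightarrow> real^'n) \<Rightarrow>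
   (nat \<Rightarrow> real^'n^'n) \<Rightarrow> (nat \<Rightarrow> real^'n) \<Rightarrow> real^'n^'n" where
  "cond_Lambda M \<phi> l X N w b = cross_cov M (frozen \<phi> l X N w b) (frozen \<phi> l X N w b)"

definition cond_Sigma ::
  "'a measure \<Rightarrow> (real \<Rightarrow> real) \<Rightarrow> nat \<Rightarrow> ('a \<Rightarrow> real^'n) \<Rightarrow> (nat \<Rightarrow> 'a \<Rightarrow> real^'n) \<Rightarrow>
   (nat \<Rightarrow> real^'n^'n) \<Rightarrow> (nat \<Rightarrow> real^'n) \<Rightarrow> real^'n^'n" where
  "cond_Sigma M \<phi> l X N w b = cross_cov M X (frozen \<phi> l X N w b)"

definition network_mutual_info ::
  "'a measure \<Rightarrow> (real \<Rightarrow> real) \<Rightarrow> nat \<Rightarrow> ('a \<Rightarrow> real^'n) \<Rightarrow> (nat \<Rightarrow> 'a \<Rightarrow> real^'n^'n) \<Rightarrow>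
   (nat \<Rightarrow> 'a \<Rightarrow> real^'n) \<Rightarrow> (nat \<Rightarrow> 'a \<Rightarrow> real^'n) \<Rightarrow> ereal" where
  "network_mutual_info M \<phi> l X W b N =
     quasi_integral M (\<lambda>\<omega>. mutual_info M X (frozen \<phi> l X N (\<lambda>i. W i \<omega>) (\<lambda>i. b i \<omega>)))"

end

theory Submission
  imports Defs
begin

text \<open>With the weights frozen, the last layer is $Y = G + N$ with $N$ a nondegenerate Gaussian
  independent of $(X, G)$, so $(X, Y)$ has a joint density, whatever $\phi$ is. For every conditional
  density $q(x \mid y)$, Gibbs' inequality gives $I(X, Y) \ge E \ln (q(X \mid Y) / p_X(X))$. Take for
  $q(\cdot \mid y)$ the normal density of the best linear prediction of $X$ from $Y$: its mean is
  $\Sigma \Lambda^{-1} (y - E Y)$, its covariance $S = \sigma_x^2 I - \Sigma \Lambda^{-1} \Sigma^T$. The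
  quadratic terms cancel in expectation and leave $\frac12 \ln (\sigma_x^{2n} / |S|)$, which is the claimed
  bound since $|S|\,|\Lambda| = \sigma_x^{2n}\,|\Lambda - \sigma_x^{-2} \Sigma^T \Sigma|$.\<close>

text \<open>Gibbs' inequality replaces differences of entropies because ln (q(X | Y) / p_X(X)) is a
  quadratic polynomial in (X, Y): finite second moments make it integrable, and infinite values are
  confined to the mutual information itself. Strict positivity of all determinants has one source:
  the covariance form of the stacked vector (X, Y) is positive definite, since a law with a density
  charges no hyperplane. The error covariance S is whitened to s I, where s is the input variance,
  and not to I, so that the reference density and the density of X share their normalising
  constants. Both quadratic terms then have mean n s, and only ln |det B|, for the whitening matrix
  B, survives. The closing determinant identity equates the two Schur complement expansions of the
  stacked covariance matrix; it is derived from det (I - A B) = det (I - B A).\<close>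

lemma quasi_integral_ge:
  assumes g: "integrable M g" and le: "AE x in M. ereal (g x) \<le> f x"
  shows "ereal (\<integral>x. g x \<partial>M) \<le> quasi_integral M f"
proof -
  have gm [measurable]: "g \<in> borel_measurable M" using g by auto
  have fin1: "(\<integral>\<^sup>+x. ennreal (g x) \<partial>M) \<noteq> \<infinity>" and fin2: "(\<integral>\<^sup>+x. ennreal (- g x) \<partial>M) \<noteq> \<infinity>"
    using g by (auto simp: real_integrable_def)
  \<comment> \<open>\<open>nn_integral\<close> is monotone for arbitrary functions. Hence
    \<open>f\<close> may later be the conditional mutual information as a function of the weights,
    whose measurability is never established.\<close>
  have 1: "(\<integral>\<^sup>+x. ennreal (g x) \<partial>M) \<le> (\<integral>\<^sup>+x. e2ennreal (f x) \<partial>M)"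
    using le by (intro nn_integral_mono_AE) (auto elim!: eventually_mono simp: ennreal.rep_eq
        simp flip: e2ennreal_ereal intro!: e2ennreal_mono)
  \<comment> \<open>This also makes the integral of the negative part of \<open>f\<close> finite, so
    the difference in \<open>quasi_integral\<close> is meaningful.\<close>
  have 2: "(\<integral>\<^sup>+x. e2ennreal (- f x) \<partial>M) \<le> (\<integral>\<^sup>+x. ennreal (- g x) \<partial>M)"
    using le
  proof (intro nn_integral_mono_AE, eventually_elim)
    fix x assume "ereal (g x) \<le> f x"
    then have "- f x \<le> ereal (- g x)" by (metis ereal_minus_le_minus uminus_ereal.simps(1))
    then show "e2ennreal (- f x) \<le> ennreal (- g x)"
      using e2ennreal_mono by fastforce
  qed
  have "ereal (\<integral>x. g x \<partial>M) = enn2ereal (\<integral>\<^sup>+x. ennreal (g x) \<partial>M) - enn2ereal (\<integral>\<^sup>+x. ennreal (- g x) \<partial>M)"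
    using fin1 fin2 unfolding real_lebesgue_integral_def[OF g]
    by (cases "\<integral>\<^sup>+x. ennreal (g x) \<partial>M"; cases "\<integral>\<^sup>+x. ennreal (- g x) \<partial>M") auto
  also have "\<dots> \<le> quasi_integral M f"
    unfolding quasi_integral_def using 1 2 by (intro ereal_minus_mono) (auto simp: less_eq_ennreal.rep_eq)
  finally show ?thesis .
qed

section \<open>Determinants\<close>

lemma matrix_diff_ldistrib: "(A :: 'a::ring_1^'n^'m) ** (B - C) = A ** B - A ** C"
  by (simp add: matrix_matrix_mult_def vec_eq_iff right_diff_distrib sum_subtractf)

lemma matrix_diff_rdistrib: "((A :: 'a::ring_1^'n^'m) - B) ** C = A ** C - B ** C"
  by (simp add: matrix_matrix_mult_def vec_eq_iff left_diff_distrib sum_subtractf)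

lemma det_scaleR: "det (c *\<^sub>R A) = c ^ CARD('n) * det A" for A :: "real^'n^'n"
proof -
  have "det (\<chi> i. c *s A $ i) = prod (\<lambda>_::'n. c) UNIV * det (\<chi> i. A $ i)"
    by (rule det_rows_mul)
  moreover have "(\<chi> i. c *s A $ i) = c *\<^sub>R A" by (simp add: vec_eq_iff)
  ultimately show ?thesis by simp
qed

text \<open>For invertible \<open>A\<close> the two matrices are conjugate. In general $A + uI$ is invertible for all small
  $u > 0$, because $\det(I + tA)$ is a nonzero polynomial in $t = 1/u$; then let $u \to 0$.\<close>

lemma det_one_minus_commute:
  fixes A B :: "real^'n^'n"
  shows "det (mat 1 - A ** B) = det (mat 1 - B ** A)"
proof -
  have inv_case: "det (mat 1 - A ** B) = det (mat 1 - B ** A)" if inv: "invertible A" for A :: "real^'n^'n"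
  proof -
    obtain A' where A': "A ** A' = mat 1" "A' ** A = mat 1"
      using inv by (auto simp: invertible_def)
    have "A ** (mat 1 - B ** A) = (mat 1 - A ** B) ** A"
      by (simp add: matrix_diff_ldistrib matrix_diff_rdistrib matrix_mul_assoc)
    then have "det A * det (mat 1 - B ** A) = det (mat 1 - A ** B) * det A"
      by (metis det_mul)
    moreover have "det A \<noteq> 0" using inv by (simp add: invertible_det_nz)
    ultimately show ?thesis by simp
  qed
  \<comment> \<open>\<open>[: c, d :]\<close> is the polynomial c + d t, so \<open>P\<close> is I +
    t A with polynomial entries and its determinant is a polynomial in t.\<close>
  define P :: "real poly^'n^'n" where "P = (\<chi> i j. [: if i = j then 1 else 0, A$i$j :])"
  have P: "poly (det P) t = det (mat 1 + t *\<^sub>R A)" for t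
    unfolding det_def P_def by (auto simp: poly_sum poly_prod mat_def of_int_poly intro!: sum.cong prod.cong)
  have "poly (det P) 0 = 1" unfolding P by simp
  then have "det P \<noteq> 0" by auto
  then have "finite {t. poly (det P) t = 0}" by (rule poly_roots_finite)
  then obtain K where K: "\<And>t. K < t \<Longrightarrow> poly (det P) t \<noteq> 0"
    by (metis (mono_tags) bdd_above_def bdd_above_finite mem_Collect_eq not_le)
  define f where "f u = det (mat 1 - (A + u *\<^sub>R mat 1) ** B) - det (mat 1 - B ** (A + u *\<^sub>R mat 1))" for u
  have f0: "f u = 0" if "0 < u" "K < 1 / u" for u
  proof -
    have "A + u *\<^sub>R mat 1 = u *\<^sub>R (mat 1 + (1/u) *\<^sub>R A)"
      using that by (simp add: algebra_simps)
    then have "det (A + u *\<^sub>R mat 1) \<noteq> 0"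
      using K[OF that(2)] that(1) unfolding P
      by (simp add: det_scaleR)
    then show ?thesis using inv_case unfolding f_def invertible_det_nz by simp
  qed
  have "continuous_on UNIV (\<lambda>u. (mat 1 - (A + u *\<^sub>R mat 1) ** B) $ i $ j)"
    "continuous_on UNIV (\<lambda>u. (mat 1 - B ** (A + u *\<^sub>R mat 1)) $ i $ j)" for i j
    by (simp_all add: matrix_matrix_mult_def) (intro continuous_intros)+
  then have "continuous_on UNIV f"
    unfolding f_def det_def
    by (intro continuous_on_diff continuous_on_sum continuous_on_mult continuous_on_prod continuous_on_const) auto
  then have "(f \<longlongrightarrow> f 0) (at_right 0)"
    by (metis continuous_on_def UNIV_I filterlim_at_split subset_UNIV tendsto_within_subset)
  moreover have "(f \<longlongrightarrow> 0) (at_right 0)"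
  proof (rule tendsto_eventually)
    \<comment> \<open>The absolute value and the added 1 keep the interval nonempty when
      \<open>K\<close> is not positive.\<close>
    have "eventually (\<lambda>u::real. u \<in> {0<..<1/(\<bar>K\<bar>+1)}) (at_right 0)"
      by (rule eventually_at_right_real) simp
    then show "\<forall>\<^sub>F u in at_right 0. f u = 0"
    proof eventually_elim
      fix u assume "u \<in> {0<..<1/(\<bar>K\<bar>+1)}"
      then have "0 < u" "\<bar>K\<bar> + 1 < 1 / u" by (auto simp: field_simps)
      then show "f u = 0" by (intro f0) auto
    qed
  qed
  ultimately have "f 0 = 0" by (rule tendsto_unique[rotated]) simp
  then show ?thesis by (simp add: f_def)
qed

section \<open>Linear change of variables\<close>

text \<open>Tonelli with the coordinate \<open>m\<close> innermost. It prepares the shear, which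
  acts along a single axis.\<close>

lemma nn_integral_lborel_axis:
  fixes h :: "real^'n \<Rightarrow> ennreal"
  assumes [measurable]: "h \<in> borel_measurable borel"
  shows "(\<integral>\<^sup>+x. h x \<partial>lborel) =
    (\<integral>\<^sup>+z. (\<integral>\<^sup>+y. h ((\<Sum>b\<in>Basis - {axis m 1}. z b *\<^sub>R b) + y *\<^sub>R axis m 1) \<partial>lborel) \<partial>Pi\<^sub>M (Basis - {axis m 1}) (\<lambda>_. lborel))"
proof -
  interpret product_sigma_finite "\<lambda>_::real^'n. lborel :: real measure" ..
  let ?e = "axis m 1 :: real^'n"
  have B: "insert ?e (Basis - {?e}) = Basis" by (auto simp: axis_in_Basis_iff)
  have "(\<integral>\<^sup>+x. h x \<partial>lborel) = (\<integral>\<^sup>+z. h (\<Sum>b\<in>Basis. z b *\<^sub>R b) \<partial>Pi\<^sub>M (insert ?e (Basis - {?e})) (\<lambda>_. lborel))"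
    unfolding B by (subst lborel_def) (simp add: nn_integral_distr lborel_eq_real lborel_def)
  also have "\<dots> = (\<integral>\<^sup>+z. (\<integral>\<^sup>+y. h (\<Sum>b\<in>Basis. (z(?e := y)) b *\<^sub>R b) \<partial>lborel) \<partial>Pi\<^sub>M (Basis - {?e}) (\<lambda>_. lborel))"
    by (rule product_nn_integral_insert) (auto simp: B)
  also have "(\<lambda>z y. \<Sum>b\<in>Basis. (z(?e := y)) b *\<^sub>R b) = (\<lambda>z y. (\<Sum>b\<in>Basis - {?e}. z b *\<^sub>R b) + y *\<^sub>R ?e)"
    by (subst B[symmetric], subst sum.insert) (auto simp: add.commute intro!: ext)
  finally show ?thesis by meson
qed

text \<open>The change of variables theorems of HOL-Analysis need a well-ordered index type, whereas here
  it is only finite. Invertible matrices are products of elementary ones, so it suffices to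
  treat diagonal matrices, transpositions and shears.\<close>

definition lborel_linear :: "real^'n^'n \<Rightarrow> bool" where
  "lborel_linear A \<longleftrightarrow> (invertible A \<longrightarrow> (\<forall>h\<in>borel_measurable borel.
     (\<integral>\<^sup>+x. h x \<partial>lborel) = ennreal \<bar>det A\<bar> * (\<integral>\<^sup>+x. h (A *v x) \<partial>lborel)))"

lemma borel_measurable_matrix_vector [measurable]: "(*v) A \<in> borel_measurable borel"
  for A :: "real^'n^'m"
  by (intro borel_measurable_continuous_onI matrix_vector_mult_linear_continuous_on)

lemma nn_integral_lborel_translate:
  fixes c :: "'a::euclidean_space"
  assumes [measurable]: "h \<in> borel_measurable borel"
  shows "(\<integral>\<^sup>+x. h (x + c) \<partial>lborel) = (\<integral>\<^sup>+x. h x \<partial>lborel)"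
proof -
  have "(\<integral>\<^sup>+x. h x \<partial>lborel) = (\<integral>\<^sup>+x. h x \<partial>distr lborel borel ((+) c))"
    by (simp add: lborel_distr_plus)
  then show ?thesis by (simp add: nn_integral_distr add.commute)
qed

lemma prod_Basis_vec: "(\<Prod>b\<in>Basis. f b) = (\<Prod>i\<in>UNIV. f (axis i 1))"
  for f :: "real^'n \<Rightarrow> 'b::comm_monoid_mult"
  by (rule prod.reindex_bij_witness[where i = "\<lambda>i. axis i 1" and j = "axis_index"])
     (auto simp: Basis_vec_def axis_eq_axis axis_index_axis)

lemma nn_integral_lborel_diagonal:
  fixes c :: "'n::finite \<Rightarrow> real"
  assumes h[measurable]: "h \<in> borel_measurable borel" and c: "\<And>i. c i \<noteq> 0"
  shows "(\<integral>\<^sup>+x. h x \<partial>lborel) = ennreal \<bar>\<Prod>i\<in>UNIV. c i\<bar> * (\<integral>\<^sup>+x. h (\<chi> i. c i * x $ i) \<partial>lborel)"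
proof -
  \<comment> \<open>The map is written in the form of \<open>lborel_affine_euclidean\<close>, with
    translation vector 0; \<open>T\<close> converts it to coordinates.\<close>
  let ?T = "\<lambda>x::real^'n. 0 + (\<Sum>j\<in>Basis. (c (axis_index j) * (x \<bullet> j)) *\<^sub>R j)"
  have T: "?T x = (\<chi> i. c i * x $ i)" for x
  proof -
    have "?T x $ i = c i * x $ i" for i
    proof -
      have "?T x $ i = (\<Sum>j\<in>Basis. (c (axis_index j) * (x \<bullet> j)) *\<^sub>R j) \<bullet> axis i 1"
        by (simp add: inner_axis)
      also have "\<dots> = c i * x $ i"
        by (subst inner_sum_left_Basis) (auto simp: axis_in_Basis_iff axis_index_axis inner_axis)
      finally show ?thesis .
    qed
    then show ?thesis by (simp add: vec_eq_iff)
  qed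
  have L: "lborel = density (distr lborel borel ?T) (\<lambda>_. (\<Prod>j\<in>Basis. \<bar>c (axis_index (j::real^'n))\<bar>))"
    using lborel_affine_euclidean[where c = "\<lambda>j::real^'n. c (axis_index j)" and t = 0] c by simp
  have "(\<integral>\<^sup>+x. h x \<partial>lborel) = ennreal (\<Prod>j\<in>Basis. \<bar>c (axis_index (j::real^'n))\<bar>) * (\<integral>\<^sup>+x. h (?T x) \<partial>lborel)"
    by (subst L) (simp add: nn_integral_density nn_integral_distr nn_integral_cmult)
  then show ?thesis unfolding T by (simp add: prod_Basis_vec axis_index_axis abs_prod)
qed

text \<open>Lebesgue measure is determined by the volumes of boxes, and swapping two coordinates
  only permutes the side lengths of a box.\<close>

lemma nn_integral_lborel_transpose:
  assumes h[measurable]: "h \<in> borel_measurable borel" and mn: "m \<noteq> n"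
  shows "(\<integral>\<^sup>+x. h x \<partial>lborel) = (\<integral>\<^sup>+x. h (\<chi> i. x $ Transposition.transpose m n i) \<partial>(lborel :: (real^'n) measure))"
proof -
  let ?T = "\<lambda>x::real^'n. \<chi> i. x $ Transposition.transpose m n i"
  have [measurable]: "?T \<in> borel_measurable borel"
    by (intro borel_measurable_continuous_onI continuous_intros)
  have "lborel = distr lborel borel ?T"
  proof (rule lborel_eqI)
    fix l u :: "real^'n" assume le: "\<And>b. b \<in> Basis \<Longrightarrow> l \<bullet> b \<le> u \<bullet> b"
    have le': "l $ i \<le> u $ i" for i
      using le[of "axis i 1"] by (simp add: inner_axis)
    have "?T -` box l u = box (?T l) (?T u)"
      unfolding set_eq_iff vimage_eq mem_box_cart vec_lambda_beta
      by (metis transpose_involutory)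
    then have "emeasure (distr lborel borel ?T) (box l u) = emeasure lborel (box (?T l) (?T u))"
      by (simp add: emeasure_distr)
    also have "\<dots> = (\<Prod>b\<in>Basis. (?T u - ?T l) \<bullet> b)"
      by (subst emeasure_lborel_box) (auto simp: Basis_vec_def inner_axis le')
    also have "(\<Prod>b\<in>Basis. (?T u - ?T l) \<bullet> b) = (\<Prod>b\<in>Basis. (u - l) \<bullet> b)"
      unfolding prod_Basis_vec
      by (rule prod.reindex_bij_witness[where i = "Transposition.transpose m n" and j = "Transposition.transpose m n"])
         (auto simp: inner_axis)
    finally show "emeasure (distr lborel borel ?T) (box l u) = (\<Prod>b\<in>Basis. (u - l) \<bullet> b)" .
  qed simp
  then have "(\<integral>\<^sup>+x. h x \<partial>lborel) = (\<integral>\<^sup>+x. h x \<partial>distr lborel borel ?T)" by simp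
  then show ?thesis by (simp add: nn_integral_distr)
qed

text \<open>On each line parallel to the axis \<open>m\<close> the coordinate \<open>n\<close> is
  constant, because \<open>m \<noteq> n\<close>. There the shear is a translation, which preserves
  the inner integral.\<close>

lemma nn_integral_lborel_shear:
  assumes h[measurable]: "h \<in> borel_measurable borel" and mn: "m \<noteq> n"
  shows "(\<integral>\<^sup>+x. h x \<partial>lborel) = (\<integral>\<^sup>+x. h (x + (x $ n) *\<^sub>R axis m 1) \<partial>(lborel :: (real^'n) measure))"
proof -
  have [measurable]: "(\<lambda>x::real^'n. x + (x $ n) *\<^sub>R axis m 1) \<in> borel_measurable borel"
    by (intro borel_measurable_continuous_onI continuous_intros)
  let ?v = "\<lambda>z. \<Sum>b\<in>Basis - {axis m 1 :: real^'n}. z b *\<^sub>R b"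
  have "(\<integral>\<^sup>+y. h (?v z + y *\<^sub>R axis m 1 + ((?v z + y *\<^sub>R axis m 1) $ n) *\<^sub>R axis m 1) \<partial>lborel)
      = (\<integral>\<^sup>+y. h (?v z + y *\<^sub>R axis m 1) \<partial>lborel)" for z
  proof -
    have "(\<integral>\<^sup>+y. h (?v z + y *\<^sub>R axis m 1) \<partial>lborel) = (\<integral>\<^sup>+y. h (?v z + (y + ?v z $ n) *\<^sub>R axis m 1) \<partial>lborel)"
      by (rule nn_integral_lborel_translate[symmetric]) measurable
    also have "\<dots> = (\<integral>\<^sup>+y. h (?v z + y *\<^sub>R axis m 1 + ((?v z + y *\<^sub>R axis m 1) $ n) *\<^sub>R axis m 1) \<partial>lborel)"
      using mn by (simp add: axis_def algebra_simps)
    finally show ?thesis by simp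
  qed
  then show ?thesis
    by (subst (1 2) nn_integral_lborel_axis[where m = m]) simp_all
qed

lemma nn_integral_lborel_linear:
  fixes A :: "real^'n^'n"
  assumes "invertible A" "h \<in> borel_measurable borel"
  shows "(\<integral>\<^sup>+x. h x \<partial>lborel) = ennreal \<bar>det A\<bar> * (\<integral>\<^sup>+x. h (A *v x) \<partial>lborel)"
proof -
  have main: "lborel_linear A"
  \<comment> \<open>In the product case the hypothesis for \<open>B\<close> is applied to
    \<open>h\<close> composed with \<open>A\<close>, which is why \<open>lborel_linear\<close>
    quantifies over \<open>h\<close>. Invertibility is a premise inside it so that matrices with a
    zero row satisfy it vacuously.\<close>
  proof (rule induct_matrix_elementary_alt)
    fix A B :: "real^'n^'n" assume AB: "lborel_linear A" "lborel_linear B"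
    show "lborel_linear (A ** B)"
      unfolding lborel_linear_def
    proof (intro impI ballI)
      fix h :: "real^'n \<Rightarrow> ennreal" assume inv_AB: "invertible (A ** B)" and h [measurable]: "h \<in> borel_measurable borel"
      have inv: "invertible A" "invertible B" using inv_AB by (simp_all add: invertible_det_nz det_mul)
      have "(\<integral>\<^sup>+x. h x \<partial>lborel) = ennreal \<bar>det A\<bar> * (\<integral>\<^sup>+x. h (A *v x) \<partial>lborel)"
        using AB(1)[unfolded lborel_linear_def, rule_format, OF inv(1) h] .
      also have "(\<integral>\<^sup>+x. h (A *v x) \<partial>lborel) = ennreal \<bar>det B\<bar> * (\<integral>\<^sup>+x. h (A *v (B *v x)) \<partial>lborel)"
        by (rule AB(2)[unfolded lborel_linear_def, rule_format, OF inv(2)]) measurable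
      finally show "(\<integral>\<^sup>+x. h x \<partial>lborel) = ennreal \<bar>det (A ** B)\<bar> * (\<integral>\<^sup>+x. h ((A ** B) *v x) \<partial>lborel)"
        by (simp add: det_mul abs_mult ennreal_mult mult.assoc matrix_vector_mul_assoc)
    qed
  next
    fix A :: "real^'n^'n" and i assume "row i A = 0"
    then show "lborel_linear A"
      by (simp add: lborel_linear_def invertible_det_nz det_zero_row)
  next
    fix A :: "real^'n^'n" assume A: "\<And>i j. i \<noteq> j \<Longrightarrow> A $ i $ j = 0"
    have d: "det A = (\<Prod>i\<in>UNIV. A $ i $ i)" by (rule det_diagonal) (use A in auto)
    have v: "A *v x = (\<chi> i. A $ i $ i * x $ i)" for x
    proof -
      have "(\<Sum>j\<in>UNIV. A $ i $ j * x $ j) = A $ i $ i * x $ i" for i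
        by (simp add: sum.remove[of _ i] A)
      then show ?thesis by (simp add: matrix_vector_mult_def)
    qed
    show "lborel_linear A"
      unfolding lborel_linear_def invertible_det_nz d v
      by (auto intro!: nn_integral_lborel_diagonal)
  next
    fix m n :: 'n assume "m \<noteq> n"
    let ?A = "(\<chi> i j. mat 1 $ i $ Transposition.transpose m n j) :: real^'n^'n"
    have "?A *v x = (\<chi> i. x $ Transposition.transpose m n i)" for x
    proof -
      have "(\<Sum>j\<in>UNIV. mat 1 $ i $ Transposition.transpose m n j * x $ j)
          = (\<Sum>j\<in>UNIV. if j = Transposition.transpose m n i then x $ j else 0)" for i
        by (rule sum.cong) (auto simp: mat_def)
      then show ?thesis
        by (simp add: matrix_vector_mult_def)
    qed
    moreover have "\<bar>det ?A\<bar> = 1"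
      by (subst det_permute_columns) (auto simp: permutes_swap_id sign_swap_id abs_mult)
    ultimately show "lborel_linear ?A"
      using nn_integral_lborel_transpose[OF _ \<open>m \<noteq> n\<close>] unfolding lborel_linear_def by (simp only: abs_one ennreal_1 mult_1_left) blast
  next
    fix m n :: 'n assume mn: "m \<noteq> n"
    let ?A = "(\<chi> i j. of_bool (i = m \<and> j = n \<or> i = j)) :: real^'n^'n"
    have "?A *v x = x + (x $ n) *\<^sub>R axis m 1" for x
    proof -
      have "of_bool (i = m \<and> j = n \<or> i = j) * x $ j
          = (if j = n then of_bool (i = m) * x $ j else 0) + (if j = i then x $ j else 0)" for i j
        using mn by auto
      then show ?thesis
        by (simp add: matrix_vector_mult_def vec_eq_iff axis_def sum.distrib)
    qed
    moreover have "det ?A = 1"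
    proof -
      have "?A = (\<chi> k. if k = m then row m (mat 1) + 1 *s row n (mat 1) else row k (mat 1))"
        using mn by (auto simp: vec_eq_iff row_def mat_def)
      then show ?thesis using det_row_operation[OF mn, where A = "mat 1 :: real^'n^'n" and c = 1] by simp
    qed
    ultimately show "lborel_linear ?A"
      using nn_integral_lborel_shear[OF _ mn] unfolding lborel_linear_def by (simp only: abs_one ennreal_1 mult_1_left) blast
  qed
  show ?thesis by (rule main[unfolded lborel_linear_def, rule_format, OF assms])
qed

section \<open>Positive definite matrices\<close>

text \<open>An orthonormal basis for the inner product u \<bullet> (S v), built one vector at a
  time. Fewer than n vectors \<open>S *v v i\<close> leave a nonzero \<open>x\<close> orthogonal to
  all of them; positivity of the form allows it to be normalised.\<close>

lemma positive_definite_orthonormal_family: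
  fixes S :: "real^'n^'n"
  assumes sym: "transpose S = S" and pos: "\<And>v. v \<noteq> 0 \<Longrightarrow> 0 < v \<bullet> (S *v v)"
  shows "\<exists>v :: 'n \<Rightarrow> real^'n. \<forall>i\<in>K. \<forall>j\<in>K. v i \<bullet> (S *v v j) = (if i = j then 1 else 0)"
  using finite[of K]
proof (induction K rule: finite_induct)
  case empty
  then show ?case by simp
next
  case (insert k K)
  then obtain v where v: "\<And>i j. i \<in> K \<Longrightarrow> j \<in> K \<Longrightarrow> v i \<bullet> (S *v v j) = (if i = j then 1 else 0)"
    by metis
  have "dim ((\<lambda>i. S *v v i) ` K) \<le> card K"
    using dim_le_card'[of "(\<lambda>i. S *v v i) ` K"] card_image_le[of K "\<lambda>i. S *v v i"] insert.hyps by simp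
  also have "\<dots> < DIM(real^'n)"
  proof -
    have "K \<subset> UNIV" using insert.hyps by auto
    then show ?thesis by (simp add: psubset_card_mono)
  qed
  finally obtain x where x: "x \<noteq> 0" "\<And>y. y \<in> span ((\<lambda>i. S *v v i) ` K) \<Longrightarrow> orthogonal x y"
    by (rule orthogonal_to_subspace_exists) blast
  have swap: "u \<bullet> (S *v w) = w \<bullet> (S *v u)" for u w
    by (metis sym dot_lmul_matrix inner_commute transpose_matrix_vector)
  let ?c = "1 / sqrt (x \<bullet> (S *v x))"
  have xv: "x \<bullet> (S *v v i) = 0" if "i \<in> K" for i
    using x(2)[of "S *v v i"] that by (auto simp: orthogonal_def span_base)
  have vx: "v i \<bullet> (S *v x) = 0" if "i \<in> K" for i
    using xv[OF that] swap by simp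
  have xx: "(?c *\<^sub>R x) \<bullet> (S *v (?c *\<^sub>R x)) = 1"
    using pos[OF x(1)] by (simp add: matrix_vector_mult_scaleR)
  show ?case
    by (rule exI[of _ "v(k := ?c *\<^sub>R x)"])
       (use insert.hyps v xx xv vx in \<open>auto simp: matrix_vector_mult_scaleR\<close>)
qed

text \<open>The rows of \<open>B\<close> are an orthonormal basis for the form of \<open>S\<close>,
  scaled by the square root of \<open>c\<close>. Thus B S transpose(B) = c I, and taking
  determinants gives the second conclusion.\<close>

lemma positive_definite_whitening:
  fixes S :: "real^'n^'n"
  assumes sym: "transpose S = S" and pos: "\<And>v. v \<noteq> 0 \<Longrightarrow> 0 < v \<bullet> (S *v v)" and c: "0 < c"
  obtains B :: "real^'n^'n"
  where "\<And>i j. B $ i \<bullet> (S *v (B $ j)) = (if i = j then c else 0)" "(det B)\<^sup>2 * det S = c ^ CARD('n)"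
proof -
  obtain v :: "'n \<Rightarrow> real^'n" where v: "\<And>i j. v i \<bullet> (S *v v j) = (if i = j then 1 else 0)"
    using positive_definite_orthonormal_family[OF sym pos, of UNIV] by auto
  define B :: "real^'n^'n" where "B = (\<chi> i. sqrt c *\<^sub>R v i)"
  have 1: "B $ i \<bullet> (S *v (B $ j)) = (if i = j then c else 0)" for i j
    using v[of i j] c by (simp add: B_def matrix_vector_mult_scaleR)
  have "(B ** (S ** transpose B)) $ i $ j = B $ i \<bullet> (S *v (B $ j))" for i j
    by (simp add: matrix_matrix_mult_def matrix_vector_mult_def inner_vec_def transpose_def)
  then have "B ** (S ** transpose B) = mat c"
    by (simp add: vec_eq_iff 1 mat_def)
  then have "det (B ** (S ** transpose B)) = det (mat c :: real^'n^'n)" by simp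
  moreover have "det (mat c :: real^'n^'n) = c ^ CARD('n)"
    by (subst det_diagonal) (auto simp: mat_def)
  ultimately have "(det B)\<^sup>2 * det S = c ^ CARD('n)"
    by (simp add: det_mul power2_eq_square ac_simps)
  with 1 show ?thesis by (rule that)
qed

lemma positive_definite_det_pos:
  fixes S :: "real^'n^'n"
  assumes "transpose S = S" "\<And>v. v \<noteq> 0 \<Longrightarrow> 0 < v \<bullet> (S *v v)"
  shows "0 < det S"
proof -
  obtain B :: "real^'n^'n" where "(det B)\<^sup>2 * det S = 1 ^ CARD('n)"
    using positive_definite_whitening[OF assms zero_less_one] by metis
  then have "0 < (det B)\<^sup>2 * det S" by simp
  then show ?thesis by (simp add: zero_less_mult_iff)
qed

section \<open>Isotropic normal vectors\<close>

lemma isotropic_normal_density_pos: "0 < v \<Longrightarrow> 0 < isotropic_normal_density v x"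
  by (simp add: isotropic_normal_density_def)

lemma borel_measurable_isotropic_normal_density [measurable]:
  "isotropic_normal_density v \<in> borel_measurable borel"
  unfolding isotropic_normal_density_def[abs_def] by measurable

lemma isotropic_normal_density_prod:
  fixes x :: "'b::euclidean_space"
  assumes "0 < v"
  shows "isotropic_normal_density v x = (\<Prod>b\<in>Basis. normal_density 0 (sqrt v) (x \<bullet> b))"
proof -
  have "(\<Prod>b\<in>Basis. normal_density 0 (sqrt v) (x \<bullet> b))
      = (1 / sqrt (2 * pi * v)) ^ DIM('b) * exp (\<Sum>b\<in>Basis. - (x \<bullet> b)\<^sup>2 / (2 * v))"
    using assms by (simp add: normal_density_def prod.distrib exp_sum prod_dividef power_one_over)
  also have "(\<Sum>b\<in>Basis. - (x \<bullet> b)\<^sup>2 / (2 * v)) = - (norm x)\<^sup>2 / (2 * v)"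
    by (simp add: norm_eq_sqrt_inner euclidean_inner[of x x] sum_nonneg power2_eq_square
        sum_negf flip: sum_divide_distrib)
  finally show ?thesis by (simp add: isotropic_normal_density_def power_one_over)
qed

lemma borel_measurable_reflect:
  "(\<lambda>x::real^'n. \<chi> i. if i = k then - x $ i else x $ i) \<in> borel_measurable borel"
proof (intro borel_measurable_continuous_onI continuous_on_vec_lambda)
  show "continuous_on UNIV (\<lambda>x::real^'n. if i = k then - x $ i else x $ i)" for i
    by (cases "i = k") (auto intro!: continuous_intros)
qed

text \<open>The isotropic normal law is invariant under a sign change of one coordinate; hence it is centred
  and its coordinates are uncorrelated.\<close>

lemma nn_integral_lborel_reflect:
  assumes h[measurable]: "h \<in> borel_measurable borel"
  shows "(\<integral>\<^sup>+x. h (\<chi> i. if i = k then - x $ i else x $ i) \<partial>lborel) = (\<integral>\<^sup>+x. h x \<partial>(lborel :: (real^'n) measure))"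
proof -
  have "(\<Prod>i\<in>UNIV. if i = k then - 1 else (1::real)) = -1" by simp
  then show ?thesis
    using nn_integral_lborel_diagonal[OF h, of "\<lambda>i. if i = k then -1 else 1"]
    by (simp add: if_distrib[of "\<lambda>x. x * _"] cong: if_cong)
qed

context
  fixes M :: "'a measure" and X :: "'a \<Rightarrow> real^'n" and s :: real
  assumes M: "prob_space M" and s: "0 < s"
    and X: "distributed M lborel X (\<lambda>x. ennreal (isotropic_normal_density s x))"
begin

lemma isotropic_normal_measurable: "X \<in> borel_measurable M"
  using distributed_measurable[OF X] by simp

lemma isotropic_normal_reflect:
  "distr M borel (\<lambda>\<omega>. \<chi> i. if i = k then - X \<omega> $ i else X \<omega> $ i) = distr M borel X"
proof -
  let ?T = "\<lambda>x::real^'n. \<chi> i. if i = k then - x $ i else x $ i"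
  note [measurable] = isotropic_normal_measurable
  have T[measurable]: "?T \<in> borel_measurable borel"
    by (rule borel_measurable_reflect)
  have n: "isotropic_normal_density s (?T x) = isotropic_normal_density s x" for x :: "real^'n"
  proof -
    have "norm (?T x) = norm x"
      unfolding norm_vec_def L2_set_def by (intro arg_cong[where f = sqrt] sum.cong) auto
    then show ?thesis by (simp add: isotropic_normal_density_def)
  qed
  have L: "distr M borel X = density lborel (\<lambda>x. ennreal (isotropic_normal_density s x))"
    using distributed_distr_eq_density[OF X] by (metis distr_cong sets_lborel)
  have "distr M borel (\<lambda>\<omega>. ?T (X \<omega>)) = distr (distr M borel X) borel ?T"
    by (simp add: distr_distr comp_def)
  also have "\<dots> = distr M borel X"
    unfolding L
  proof (rule measure_eqI)
    fix A assume "A \<in> sets (distr (density lborel (\<lambda>x. ennreal (isotropic_normal_density s x))) borel ?T)"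
    then have [measurable]: "A \<in> sets borel" by simp
    have indicator_T: "indicator (?T -` A) x = (indicator A (?T x) :: ennreal)" for x
      by (simp add: indicator_def)
    have [measurable]: "?T -` A \<in> sets borel"
      using measurable_sets[OF T, of A] by simp
    have "emeasure (distr (density lborel (\<lambda>x. ennreal (isotropic_normal_density s x))) borel ?T) A
        = (\<integral>\<^sup>+x. ennreal (isotropic_normal_density s (?T x)) * indicator A (?T x) \<partial>lborel)"
      unfolding n indicator_T[symmetric] by (simp add: emeasure_distr emeasure_density)
    also have "\<dots> = (\<integral>\<^sup>+x. ennreal (isotropic_normal_density s x) * indicator A x \<partial>lborel)"
      by (rule nn_integral_lborel_reflect) measurable
    finally show "emeasure (distr (density lborel (\<lambda>x. ennreal (isotropic_normal_density s x))) borel ?T) A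
        = emeasure (density lborel (\<lambda>x. ennreal (isotropic_normal_density s x))) A"
      by (simp add: emeasure_density)
  qed simp
  finally show ?thesis .
qed

lemma isotropic_normal_integral_reflect:
  fixes g :: "real^'n \<Rightarrow> real"
  assumes [measurable]: "g \<in> borel_measurable borel"
  shows "(\<integral>\<omega>. g (\<chi> i. if i = k then - X \<omega> $ i else X \<omega> $ i) \<partial>M) = (\<integral>\<omega>. g (X \<omega>) \<partial>M)"
proof -
  note [measurable] = isotropic_normal_measurable
  have [measurable]: "(\<lambda>\<omega>. \<chi> i. if i = k then - X \<omega> $ i else X \<omega> $ i) \<in> borel_measurable M"
    by (rule measurable_compose[OF isotropic_normal_measurable borel_measurable_reflect])
  have "(\<integral>\<omega>. g (\<chi> i. if i = k then - X \<omega> $ i else X \<omega> $ i) \<partial>M)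
     = (\<integral>x. g x \<partial>distr M borel (\<lambda>\<omega>. \<chi> i. if i = k then - X \<omega> $ i else X \<omega> $ i))"
    by (rule integral_distr[symmetric]) measurable
  also have "\<dots> = (\<integral>\<omega>. g (X \<omega>) \<partial>M)"
    unfolding isotropic_normal_reflect by (rule integral_distr) measurable
  finally show ?thesis .
qed

lemma isotropic_normal_mean: "(\<integral>\<omega>. X \<omega> $ i \<partial>M) = 0"
  using isotropic_normal_integral_reflect[of "\<lambda>x. x $ i" i] by simp

lemma isotropic_normal_uncorrelated: "i \<noteq> j \<Longrightarrow> (\<integral>\<omega>. X \<omega> $ i * X \<omega> $ j \<partial>M) = 0"
  using isotropic_normal_integral_reflect[of "\<lambda>x. x $ i * x $ j" i] by simp

text \<open>The density is a product over coordinates, and the squared coordinate belongs to one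
  factor only. One of the one-dimensional integrals is therefore the variance \<open>s\<close>, and
  the others are 1.\<close>

lemma isotropic_normal_second_moment:
  "integrable M (\<lambda>\<omega>. (X \<omega> $ i)\<^sup>2)" "(\<integral>\<omega>. (X \<omega> $ i)\<^sup>2 \<partial>M) = s"
proof -
  note [measurable] = isotropic_normal_measurable
  have [measurable]: "(\<lambda>\<omega>. X \<omega> $ i) \<in> borel_measurable M"
    by (rule measurable_compose[OF isotropic_normal_measurable borel_measurable_nth])
  then have Xsq: "(\<lambda>\<omega>. (X \<omega> $ i)\<^sup>2) \<in> borel_measurable M"
    by (rule borel_measurable_power)
  let ?f = "\<lambda>b t. normal_density 0 (sqrt s) t * (if b = axis i (1::real) then t\<^sup>2 else 1)"
  have 1: "(\<integral>\<^sup>+t. ennreal (normal_density 0 (sqrt s) t) \<partial>lborel) = 1"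
    using s by (intro nn_integral_eq_integral[THEN trans]) (auto simp: integrable_normal_density)
  have 2: "(\<integral>\<^sup>+t. ennreal (normal_density 0 (sqrt s) t * t\<^sup>2) \<partial>lborel) = ennreal s"
  proof -
    have "has_bochner_integral lborel (\<lambda>x. normal_density 0 (sqrt s) x * x\<^sup>2) s"
      using normal_moment_even[of "sqrt s" 0 1] s by (simp add: fact_2)
    then show ?thesis
      by (subst nn_integral_eq_integral) (auto simp: has_bochner_integral_iff)
  qed
  have "(\<integral>\<^sup>+\<omega>. ennreal ((X \<omega> $ i)\<^sup>2) \<partial>M)
      = (\<integral>\<^sup>+x. ennreal (isotropic_normal_density s x) * ennreal ((x $ i)\<^sup>2) \<partial>lborel)"
    by (rule distributed_nn_integral[OF X, symmetric]) measurable
  also have "\<dots> = (\<integral>\<^sup>+x. (\<Prod>b\<in>Basis. ennreal (?f b (x \<bullet> b))) \<partial>(lborel :: (real^'n) measure))"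
  proof (rule nn_integral_cong)
    fix x :: "real^'n"
    have "(\<Prod>b\<in>Basis. ?f b (x \<bullet> b)) = isotropic_normal_density s x * (x $ i)\<^sup>2"
      unfolding prod.distrib isotropic_normal_density_prod[OF s, symmetric]
      by (simp add: prod.delta axis_in_Basis_iff inner_axis)
    then show "ennreal (isotropic_normal_density s x) * ennreal ((x $ i)\<^sup>2) = (\<Prod>b\<in>Basis. ennreal (?f b (x \<bullet> b)))"
      by (subst prod_ennreal) (auto simp: ennreal_mult'' simp del: prod.delta)
  qed
  also have "\<dots> = (\<Prod>b\<in>(Basis :: (real^'n) set). \<integral>\<^sup>+t. ennreal (?f b t) \<partial>lborel)"
    by (rule nn_integral_lborel_prod) auto
  also have "\<dots> = (\<Prod>b\<in>(Basis :: (real^'n) set). if b = axis i 1 then ennreal s else 1)"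
    by (rule prod.cong) (auto simp: 1 2)
  also have "\<dots> = ennreal s" by (simp add: axis_in_Basis_iff)
  finally have *: "(\<integral>\<^sup>+\<omega>. ennreal ((X \<omega> $ i)\<^sup>2) \<partial>M) = ennreal s" .
  show "integrable M (\<lambda>\<omega>. (X \<omega> $ i)\<^sup>2)"
    by (rule integrableI_nn_integral_finite[OF Xsq _ *]) simp
  show "(\<integral>\<omega>. (X \<omega> $ i)\<^sup>2 \<partial>M) = s"
    using s by (subst integral_eq_nn_integral[OF Xsq]) (simp_all only: *, simp_all)
qed

end

section \<open>Mutual information and reference densities\<close>

text \<open>Radon-Nikodym. The conversion to a real value in \<open>density_of\<close> changes the
  derivative only where it is infinite, which is a null set because the law is finite.\<close>

lemma distributed_density_of:
  assumes M: "prob_space M" and S: "sigma_finite_measure S" and Z [measurable]: "Z \<in> measurable M S"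
    and ac: "absolutely_continuous S (distr M S Z)"
  shows "distributed M S Z (\<lambda>z. ennreal (density_of M S Z z))"
proof -
  interpret sigma_finite_measure S by fact
  interpret D: prob_space "distr M S Z" by (rule prob_space.prob_space_distr[OF M Z])
  have "AE z in S. RN_deriv S (distr M S Z) z \<noteq> \<infinity>"
    by (rule RN_deriv_finite[OF D.sigma_finite_measure ac]) simp
  then have "AE z in S. ennreal (density_of M S Z z) = RN_deriv S (distr M S Z) z"
    by eventually_elim (simp add: density_of_def top.not_eq_extremum)
  then have "density S (\<lambda>z. ennreal (density_of M S Z z)) = density S (RN_deriv S (distr M S Z))"
    by (intro density_cong) (auto simp: density_of_def)
  also have "\<dots> = distr M S Z"
    by (rule density_RN_deriv[OF ac]) simp
  finally show ?thesis
    unfolding distributed_def density_of_def by simp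
qed

text \<open>This is ln t \<le> t - 1 at t = q c / p. Here \<open>p\<close> is the joint density,
  \<open>a\<close> and \<open>c\<close> are the marginals and \<open>q\<close> is the reference
  conditional density; the corrections \<open>p\<close> and \<open>q * c\<close> have equal
  integrals later.\<close>

lemma gibbs_pointwise:
  fixes p q a c :: real
  assumes "0 \<le> p" "0 < q" "0 < a" "0 \<le> c" "0 < p \<Longrightarrow> 0 < c"
  shows "p * ln (q / a) + p - q * c \<le> p * ln (p / (a * c))"
proof (cases "p = 0")
  case True
  with assms show ?thesis by simp
next
  case False
  with assms have pos: "0 < p" "0 < c" by auto
  have "ln (q * c / p) \<le> q * c / p - 1"
    using pos assms by (intro ln_le_minus_one) simp
  then have "p * ln (q * c / p) \<le> q * c - p"
    using mult_left_mono[of "ln (q * c / p)" "q * c / p - 1" p] pos by (simp add: algebra_simps)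
  moreover have "ln (p / (a * c)) = ln (q / a) - ln (q * c / p)"
    using pos assms by (simp add: ln_div ln_mult)
  then have "p * ln (p / (a * c)) = p * ln (q / a) - p * ln (q * c / p)"
    by (simp add: right_diff_distrib)
  ultimately show ?thesis by linarith
qed

text \<open>Gibbs' inequality: replacing the true conditional density of $X$ given $Y$ by any other
  conditional density $q$ can only decrease the expected logarithm. Integrating the pointwise bound
  uses $\int p = \int\!\!\int q(x, y)\, p_Y(y)\,dx\,dy = 1$.\<close>

lemma mutual_info_ge_reference:
  fixes X :: "'a \<Rightarrow> 'b::euclidean_space" and Y :: "'a \<Rightarrow> 'c::euclidean_space"
  assumes M: "prob_space M"
    and X: "distributed M lborel X (\<lambda>x. ennreal (a x))" and a: "\<And>x. 0 < a x"
    and Y [measurable]: "Y \<in> borel_measurable M"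
    and ac: "absolutely_continuous (lborel \<Otimes>\<^sub>M lborel) (distr M (lborel \<Otimes>\<^sub>M lborel) (\<lambda>\<omega>. (X \<omega>, Y \<omega>)))"
    and q [measurable]: "(\<lambda>(x, y). q x y) \<in> borel_measurable borel" and q_pos: "\<And>x y. 0 < q x y"
    and q_int: "\<And>y. (\<integral>\<^sup>+x. ennreal (q x y) \<partial>lborel) = 1"
    and L: "integrable M (\<lambda>\<omega>. ln (q (X \<omega>) (Y \<omega>) / a (X \<omega>)))"
  shows "ereal (\<integral>\<omega>. ln (q (X \<omega>) (Y \<omega>) / a (X \<omega>)) \<partial>M) \<le> mutual_info M X Y"
proof -
  interpret prob_space M by fact
  have Xm [measurable]: "X \<in> borel_measurable M" using distributed_measurable[OF X] by simp
  have am [measurable]: "a \<in> borel_measurable borel"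
    using distributed_real_measurable[OF _ X] a by (simp add: less_imp_le)
  have XYm [measurable]: "(\<lambda>\<omega>. (X \<omega>, Y \<omega>)) \<in> measurable M (lborel \<Otimes>\<^sub>M lborel)"
    by measurable
  let ?S = "lborel \<Otimes>\<^sub>M lborel :: ('b \<times> 'c) measure"
  have qm [measurable]: "(\<lambda>(x, y). q x y) \<in> borel_measurable ?S"
    using q by (simp add: lborel_prod)
  define p where "p = density_of M ?S (\<lambda>\<omega>. (X \<omega>, Y \<omega>))"
  define r where "r = density_of M lborel Y"
  have p: "distributed M ?S (\<lambda>\<omega>. (X \<omega>, Y \<omega>)) (\<lambda>z. ennreal (p z))"
    unfolding p_def by (rule distributed_density_of[OF M _ XYm ac]) (simp add: lborel_prod lborel.sigma_finite_measure_axioms)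
  have p0: "0 \<le> p z" and r0: "0 \<le> r y" for z y by (simp_all add: p_def r_def density_of_def)
  have pm [measurable]: "p \<in> borel_measurable ?S"
    using distributed_real_measurable[OF _ p] p0 by simp
  have "absolutely_continuous lborel (distr M lborel Y)"
    unfolding absolutely_continuous_def
  proof
    fix N assume N: "N \<in> null_sets (lborel :: 'c measure)"
    then have [measurable]: "N \<in> sets borel" by auto
    \<comment> \<open>The cylinder has measure \<infinity> * 0, which is 0 in
      \<open>ennreal\<close>.\<close>
    have "UNIV \<times> N \<in> null_sets ?S"
      using N by (auto simp: null_sets_def lborel.emeasure_pair_measure_Times)
    then have "UNIV \<times> N \<in> null_sets (distr M ?S (\<lambda>\<omega>. (X \<omega>, Y \<omega>)))"
      using ac by (auto simp: absolutely_continuous_def)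
    then have "emeasure M ((\<lambda>\<omega>. (X \<omega>, Y \<omega>)) -` (UNIV \<times> N) \<inter> space M) = 0"
      by (simp add: null_sets_def emeasure_distr)
    then show "N \<in> null_sets (distr M lborel Y)"
      by (simp add: null_sets_def emeasure_distr vimage_def)
  qed
  then have r: "distributed M lborel Y (\<lambda>y. ennreal (r y))"
    unfolding r_def by (intro distributed_density_of[OF M]) (auto simp: lborel.sigma_finite_measure_axioms)
  have rm [measurable]: "r \<in> borel_measurable borel"
    using distributed_real_measurable[OF _ r] r0 by simp
  have MI: "mutual_info M X Y = quasi_integral ?S (\<lambda>(x, y). ereal (p (x, y) * ln (p (x, y) / (a x * r y))))"
    by (rule mutual_info_distributed[OF M p p0 X _ r r0]) (simp add: a less_imp_le)
  \<comment> \<open>The density of \<open>Y\<close> is almost surely positive at \<open>Y\<close>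
    itself. Read through the joint density, this says that \<open>r\<close> is positive almost
    everywhere on the set where \<open>p\<close> is, as \<open>gibbs_pointwise\<close>
    requires.\<close>
  have "AE y in lborel. 0 < ennreal (r y) \<longrightarrow> 0 < r y" by (simp add: ennreal_less_zero_iff)
  then have "AE \<omega> in M. 0 < r (Y \<omega>)"
    by (subst distributed_AE2[OF r]) auto
  then have rpos: "AE z in ?S. 0 < p z \<longrightarrow> 0 < r (snd z)"
    using distributed_AE2[OF p, of "\<lambda>z. 0 < r (snd z)"] by (auto simp: ennreal_less_zero_iff)
  let ?l = "\<lambda>(x, y). ln (q x y / a x)"
  let ?qr = "\<lambda>(x, y). q x y * r y"
  have lm [measurable]: "?l \<in> borel_measurable ?S" and qrm [measurable]: "?qr \<in> borel_measurable ?S"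
    by measurable
  have int_pl: "integrable ?S (\<lambda>z. p z * ?l z)" "(\<integral>z. p z * ?l z \<partial>?S) = (\<integral>\<omega>. ln (q (X \<omega>) (Y \<omega>) / a (X \<omega>)) \<partial>M)"
    using distributed_integrable[OF p lm] distributed_integral[OF p lm] L p0 by auto
  have int_p: "integrable ?S p" "(\<integral>z. p z \<partial>?S) = 1"
    using distributed_integrable[OF p, of "\<lambda>_. 1"] distributed_integral[OF p, of "\<lambda>_. 1"] p0
    by (auto simp: prob_space)
  have "(\<integral>\<^sup>+z. ennreal (?qr z) \<partial>?S) = (\<integral>\<^sup>+y. \<integral>\<^sup>+x. ennreal (q x y * r y) \<partial>lborel \<partial>lborel)"
    by (subst lborel_pair.nn_integral_snd[symmetric]) (auto simp: case_prod_beta)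
  also have "\<dots> = (\<integral>\<^sup>+y. ennreal (r y) \<partial>lborel)"
  proof (rule nn_integral_cong)
    fix y :: 'c
    have [measurable]: "(\<lambda>x. q x y) \<in> borel_measurable borel"
      using measurable_compose[OF _ qm, of "\<lambda>x. (x, y)" lborel] by simp
    show "(\<integral>\<^sup>+x. ennreal (q x y * r y) \<partial>lborel) = ennreal (r y)"
      using q_pos r0 q_int by (simp add: ennreal_mult less_imp_le nn_integral_multc)
  qed
  also have "\<dots> = 1"
    using distributed_nn_integral[OF r, of "\<lambda>_. 1"] by (simp add: emeasure_space_1)
  finally have qr: "(\<integral>\<^sup>+z. ennreal (?qr z) \<partial>?S) = ennreal 1" by simp
  have qr0: "0 \<le> ?qr z" for z using q_pos r0 by (auto simp: less_imp_le split: prod.split)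
  have int_qr: "integrable ?S ?qr"
    by (rule integrableI_nn_integral_finite[OF qrm _ qr]) (use qr0 in auto)
  have int_qr1: "(\<integral>z. ?qr z \<partial>?S) = 1"
    by (rule integral_eq_nn_integral[THEN trans, OF qrm]) (use qr0 qr in auto)
  have "(\<integral>\<omega>. ln (q (X \<omega>) (Y \<omega>) / a (X \<omega>)) \<partial>M) = (\<integral>z. p z * ?l z + p z - ?qr z \<partial>?S)"
    using int_pl int_p int_qr int_qr1 by simp
  also have "ereal \<dots> \<le> mutual_info M X Y"
    unfolding MI
  proof (rule quasi_integral_ge)
    show "integrable ?S (\<lambda>z. p z * ?l z + p z - ?qr z)"
      using int_pl int_p int_qr by auto
    show "AE z in ?S. ereal (p z * ?l z + p z - ?qr z) \<le> (case z of (x, y) \<Rightarrow> ereal (p (x, y) * ln (p (x, y) / (a x * r y))))"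
      using rpos
      by eventually_elim (auto split: prod.split intro!: gibbs_pointwise q_pos a r0 p0)
  qed
  finally show ?thesis .
qed

section \<open>Second moments and the Gaussian bound for fixed weights\<close>

lemma integrable_product_of_squares:
  fixes f g :: "'a \<Rightarrow> real"
  assumes [measurable]: "f \<in> borel_measurable M" "g \<in> borel_measurable M"
    and "integrable M (\<lambda>x. (f x)\<^sup>2)" "integrable M (\<lambda>x. (g x)\<^sup>2)"
  shows "integrable M (\<lambda>x. f x * g x)"
proof (rule Bochner_Integration.integrable_bound)
  show "integrable M (\<lambda>x. (f x)\<^sup>2 + (g x)\<^sup>2)"
    using assms(3,4) by (rule Bochner_Integration.integrable_add)
  have "norm (u * v) \<le> norm (u\<^sup>2 + v\<^sup>2)" for u v :: real
  proof -
    have "2 * \<bar>u\<bar> * \<bar>v\<bar> \<le> u\<^sup>2 + v\<^sup>2"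
      using sum_squares_bound[of "\<bar>u\<bar>" "\<bar>v\<bar>"] by simp
    moreover have "0 \<le> \<bar>u\<bar> * \<bar>v\<bar>" by simp
    ultimately show ?thesis unfolding real_norm_def abs_mult by linarith
  qed
  then show "AE x in M. norm (f x * g x) \<le> norm ((f x)\<^sup>2 + (g x)\<^sup>2)"
    by simp
qed measurable

lemma bilinear_expectation:
  fixes F :: "'a \<Rightarrow> real^'m" and G :: "'a \<Rightarrow> real^'n"
  assumes "\<And>i j. integrable M (\<lambda>\<omega>. F \<omega> $ i * G \<omega> $ j)"
  shows "integrable M (\<lambda>\<omega>. (u \<bullet> F \<omega>) * (v \<bullet> G \<omega>))"
    and "(\<integral>\<omega>. (u \<bullet> F \<omega>) * (v \<bullet> G \<omega>) \<partial>M) = u \<bullet> ((\<chi> i j. \<integral>\<omega>. F \<omega> $ i * G \<omega> $ j \<partial>M) *v v)"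
proof -
  have eq: "(u \<bullet> F \<omega>) * (v \<bullet> G \<omega>) = (\<Sum>i\<in>UNIV. \<Sum>j\<in>UNIV. (u $ i * v $ j) * (F \<omega> $ i * G \<omega> $ j))" for \<omega>
    by (simp add: inner_vec_def sum_product ac_simps)
  show "integrable M (\<lambda>\<omega>. (u \<bullet> F \<omega>) * (v \<bullet> G \<omega>))"
    unfolding eq using assms by auto
  show "(\<integral>\<omega>. (u \<bullet> F \<omega>) * (v \<bullet> G \<omega>) \<partial>M) = u \<bullet> ((\<chi> i j. \<integral>\<omega>. F \<omega> $ i * G \<omega> $ j \<partial>M) *v v)"
    unfolding eq using assms
    by (simp add: inner_vec_def matrix_vector_mult_def sum_distrib_left ac_simps)
qed

lemma null_sets_hyperplane:
  fixes w :: "'a::euclidean_space"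
  assumes "w \<noteq> 0"
  shows "{z. w \<bullet> z = c} \<in> null_sets lborel"
proof -
  have "closed {z. w \<bullet> z = c}" by (rule closed_hyperplane)
  moreover have "{z. w \<bullet> z = c} \<in> null_sets lebesgue"
    using negligible_hyperplane[of w c] assms by (simp add: negligible_iff_null_sets)
  ultimately show ?thesis by (simp add: null_sets_completion_iff)
qed

text \<open>Translation and the linear change of variables reduce the mass to that of the density of
  \<open>X\<close>, which is 1 because \<open>X\<close> has a probability law. No Gaussian integral
  is computed.\<close>

lemma nn_integral_affine_isotropic_normal:
  fixes B :: "real^'n^'n" and X :: "'a \<Rightarrow> real^'n"
  assumes M: "prob_space M" and X: "distributed M lborel X (\<lambda>x. ennreal (isotropic_normal_density s x))"
    and s: "0 < s" and B: "det B \<noteq> 0"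
  shows "(\<integral>\<^sup>+x. ennreal (\<bar>det B\<bar> * isotropic_normal_density s (B *v (x - c))) \<partial>lborel) = 1"
proof -
  interpret prob_space M by fact
  let ?h = "\<lambda>x::real^'n. ennreal (isotropic_normal_density s x)"
  have "(\<integral>\<^sup>+x. ennreal (\<bar>det B\<bar> * isotropic_normal_density s (B *v (x - c))) \<partial>lborel)
      = ennreal \<bar>det B\<bar> * (\<integral>\<^sup>+x. ?h (B *v (x + - c)) \<partial>lborel)"
  proof -
    have [measurable]: "(\<lambda>x. B *v (x - c)) \<in> borel_measurable borel" by measurable
    have "0 \<le> isotropic_normal_density s y" for y :: "real^'n"
      using isotropic_normal_density_pos[OF s] by (rule less_imp_le)
    then show ?thesis by (simp add: ennreal_mult nn_integral_cmult)
  qed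
  also have "(\<integral>\<^sup>+x. ?h (B *v (x + - c)) \<partial>lborel) = (\<integral>\<^sup>+x. ?h (B *v x) \<partial>lborel)"
    by (rule nn_integral_lborel_translate) measurable
  also have "ennreal \<bar>det B\<bar> * \<dots> = (\<integral>\<^sup>+x. ?h x \<partial>lborel)"
    by (rule nn_integral_lborel_linear[symmetric]) (use B in \<open>auto simp: invertible_det_nz\<close>)
  also have "\<dots> = 1"
    using distributed_nn_integral[OF X, of "\<lambda>_. 1"] by (simp add: emeasure_space_1)
  finally show ?thesis .
qed

text \<open>The inequality for one fixed choice of weights. Absolute continuity of the joint law
  makes both determinants strictly positive, so each \<open>ln\<close> is a genuine
  logarithm.\<close>

lemma mutual_info_gaussian_bound:
  fixes M :: "'a measure" and X Y :: "'a \<Rightarrow> real^'n" and s :: real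
  defines "\<Lambda> \<equiv> cross_cov M Y Y" and "\<Sigma> \<equiv> cross_cov M X Y"
  assumes M: "prob_space M" and s: "0 < s"
    and X: "distributed M lborel X (\<lambda>x. ennreal (isotropic_normal_density s x))"
    and Y [measurable]: "Y \<in> borel_measurable M"
    and Y2: "\<And>j. integrable M (\<lambda>\<omega>. (Y \<omega> $ j)\<^sup>2)"
    and ac: "absolutely_continuous (lborel \<Otimes>\<^sub>M lborel) (distr M (lborel \<Otimes>\<^sub>M lborel) (\<lambda>\<omega>. (X \<omega>, Y \<omega>)))"
  shows "ereal (1/2 * ln (det \<Lambda>) - 1/2 * ln (det (\<Lambda> - (1 / s) *\<^sub>R (transpose \<Sigma> ** \<Sigma>)))) \<le> mutual_info M X Y"
proof -
  interpret prob_space M by fact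
  have Xm [measurable]: "X \<in> borel_measurable M" by (rule isotropic_normal_measurable[OF M s X])
  have Xi [measurable]: "(\<lambda>\<omega>. X \<omega> $ i) \<in> borel_measurable M"
    and Yi [measurable]: "(\<lambda>\<omega>. Y \<omega> $ i) \<in> borel_measurable M" for i
    by (rule measurable_compose[OF _ borel_measurable_nth], measurable)+
  define \<mu> where "\<mu> = (\<chi> j. \<integral>\<omega>. Y \<omega> $ j \<partial>M)"
  define V where "V \<omega> = Y \<omega> - \<mu>" for \<omega>
  have Vi [measurable]: "(\<lambda>\<omega>. V \<omega> $ i) \<in> borel_measurable M" for i
    by (simp add: V_def)
  note X2 = isotropic_normal_second_moment[OF M s X]
  have Y1: "integrable M (\<lambda>\<omega>. Y \<omega> $ j)" for j
    using integrable_product_of_squares[OF Yi, of "\<lambda>_. 1" j] Y2 by simp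
  have V2: "integrable M (\<lambda>\<omega>. (V \<omega> $ j)\<^sup>2)" for j
    using Y1 Y2 by (simp add: V_def power2_diff)
  have iXX: "integrable M (\<lambda>\<omega>. X \<omega> $ i * X \<omega> $ j)"
    and iXV: "integrable M (\<lambda>\<omega>. X \<omega> $ i * V \<omega> $ j)"
    and iVV: "integrable M (\<lambda>\<omega>. V \<omega> $ i * V \<omega> $ j)" for i j
    by (intro integrable_product_of_squares Xi Vi X2 V2)+
  have \<Lambda>: "\<Lambda> = (\<chi> i j. \<integral>\<omega>. V \<omega> $ i * V \<omega> $ j \<partial>M)"
    by (simp add: \<Lambda>_def cross_cov_def V_def \<mu>_def)
  have \<Sigma>: "\<Sigma> = (\<chi> i j. \<integral>\<omega>. X \<omega> $ i * V \<omega> $ j \<partial>M)"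
    by (simp add: \<Sigma>_def cross_cov_def V_def \<mu>_def isotropic_normal_mean[OF M s X])
  have XX: "(\<chi> i j. \<integral>\<omega>. X \<omega> $ i * X \<omega> $ j \<partial>M) = s *\<^sub>R mat 1"
    using X2(2) by (simp add: vec_eq_iff mat_def isotropic_normal_uncorrelated[OF M s X] flip: power2_eq_square)
  note eXX = bilinear_expectation[where F = X and G = X, OF iXX, unfolded XX]
    and eXV = bilinear_expectation[where F = X and G = V, OF iXV, folded \<Sigma>]
    and eVV = bilinear_expectation[where F = V and G = V, OF iVV, folded \<Lambda>]
  have sqr: "(u \<bullet> X \<omega> + v \<bullet> V \<omega>)\<^sup>2 = (u \<bullet> X \<omega>) * (u \<bullet> X \<omega>) + 2 * ((u \<bullet> X \<omega>) * (v \<bullet> V \<omega>)) + (v \<bullet> V \<omega>) * (v \<bullet> V \<omega>)" for u v \<omega>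
    by (simp add: power2_eq_square algebra_simps)
  have int_sqr: "integrable M (\<lambda>\<omega>. (u \<bullet> X \<omega> + v \<bullet> V \<omega>)\<^sup>2)" for u v
    unfolding sqr using eXX(1) eXV(1) eVV(1) by auto
  \<comment> \<open>The right-hand side is the quadratic form of the stacked covariance matrix at
    (u, v).\<close>
  have quad: "(\<integral>\<omega>. (u \<bullet> X \<omega> + v \<bullet> V \<omega>)\<^sup>2 \<partial>M) = s * (u \<bullet> u) + 2 * (u \<bullet> (\<Sigma> *v v)) + v \<bullet> (\<Lambda> *v v)" for u v
    unfolding sqr using eXX eXV eVV by (simp add: scaleR_matrix_vector_assoc[symmetric])
  \<comment> \<open>A degenerate combination would put the joint law on a hyperplane, which is Lebesgue null.\<close>
  have pos: "0 < s * (u \<bullet> u) + 2 * (u \<bullet> (\<Sigma> *v v)) + v \<bullet> (\<Lambda> *v v)" if uv: "u \<noteq> 0 \<or> v \<noteq> 0" for u v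
  proof (rule ccontr)
    assume "\<not> ?thesis"
    then have "(\<integral>\<omega>. (u \<bullet> X \<omega> + v \<bullet> V \<omega>)\<^sup>2 \<partial>M) = 0"
      unfolding quad[symmetric] by (simp add: eq_iff not_less)
    then have "AE \<omega> in M. u \<bullet> X \<omega> + v \<bullet> V \<omega> = 0"
      by (subst (asm) integral_nonneg_eq_0_iff_AE[OF int_sqr]) auto
    moreover have "AE \<omega> in M. u \<bullet> X \<omega> + v \<bullet> V \<omega> \<noteq> 0"
    proof -
      \<comment> \<open>Since \<open>V\<close> is \<open>Y - \<mu>\<close>, the vanishing of the
        centred combination means that (X, Y) lies on this hyperplane.\<close>
      have "{z. (u, v) \<bullet> z = v \<bullet> \<mu>} \<in> null_sets (lborel \<Otimes>\<^sub>M lborel)"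
        using uv unfolding lborel_prod by (intro null_sets_hyperplane) (auto simp: zero_prod_def)
      then have "{z. (u, v) \<bullet> z = v \<bullet> \<mu>} \<in> null_sets (distr M (lborel \<Otimes>\<^sub>M lborel) (\<lambda>\<omega>. (X \<omega>, Y \<omega>)))"
        using ac by (auto simp: absolutely_continuous_def)
      then have "AE z in distr M (lborel \<Otimes>\<^sub>M lborel) (\<lambda>\<omega>. (X \<omega>, Y \<omega>)). (u, v) \<bullet> z \<noteq> v \<bullet> \<mu>"
        by (auto dest: AE_not_in)
      then have "AE \<omega> in M. (u, v) \<bullet> (X \<omega>, Y \<omega>) \<noteq> v \<bullet> \<mu>"
        by (rule AE_distrD[rotated]) measurable
      then show ?thesis
        by eventually_elim (simp add: V_def inner_diff_right inner_Pair)
    qed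
    ultimately have "AE \<omega> in M. False" by eventually_elim simp
    then show False by simp
  qed
  have sym\<Lambda>: "transpose \<Lambda> = \<Lambda>"
    by (simp add: \<Lambda> transpose_def vec_eq_iff mult.commute)
  have pos\<Lambda>: "0 < v \<bullet> (\<Lambda> *v v)" if "v \<noteq> 0" for v
    using pos[of 0 v] that by simp
  have det\<Lambda>: "0 < det \<Lambda>" by (rule positive_definite_det_pos[OF sym\<Lambda> pos\<Lambda>])
  then obtain \<Lambda>' where \<Lambda>': "\<Lambda>' ** \<Lambda> = mat 1"
    by (metis invertible_det_nz invertible_def less_irrefl)
  \<comment> \<open>The best linear predictor of \<open>X\<close> from \<open>Y\<close>, and the covariance \<open>S\<close> of its error.\<close>
  define A where "A = \<Sigma> ** \<Lambda>'"
  have A\<Lambda>: "A ** \<Lambda> = \<Sigma>" by (simp add: A_def \<Lambda>' flip: matrix_mul_assoc)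
  then have \<Lambda>A: "\<Lambda> ** transpose A = transpose \<Sigma>"
    by (metis matrix_transpose_mul sym\<Lambda>)
  define S where "S = s *\<^sub>R mat 1 - \<Sigma> ** transpose A"
  have symS: "transpose S = S"
  proof -
    have "transpose (\<Sigma> ** transpose A) = \<Sigma> ** transpose A"
      by (metis A\<Lambda> \<Lambda>A matrix_mul_assoc matrix_transpose_mul transpose_transpose)
    then show ?thesis unfolding S_def by (simp add: transpose_def vec_eq_iff mat_def)
  qed
  \<comment> \<open>The variance of the prediction error X - A V in direction \<open>v\<close>. By
    \<open>\<Lambda>A\<close> the quadratic term in \<Lambda> equals v \<bullet> (\<Sigma> w) with w
    = transpose(A) v, so it cancels half of the mixed term.\<close>
  have resid: "(\<integral>\<omega>. (v \<bullet> X \<omega> + (- (transpose A *v v)) \<bullet> V \<omega>)\<^sup>2 \<partial>M) = v \<bullet> (S *v v)" for v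
  proof -
    let ?w = "transpose A *v v"
    have "?w \<bullet> (\<Lambda> *v ?w) = ?w \<bullet> (transpose \<Sigma> *v v)"
      by (simp only: matrix_vector_mul_assoc \<Lambda>A)
    also have "\<dots> = v \<bullet> (\<Sigma> *v ?w)"
      by (metis dot_lmul_matrix inner_commute transpose_matrix_vector)
    finally have w: "?w \<bullet> (\<Lambda> *v ?w) = v \<bullet> (\<Sigma> *v ?w)" .
    have neg: "C *v (- x) = - (C *v x)" for C :: "real^'n^'n" and x
      by (simp add: matrix_vector_mult_def vec_eq_iff sum_negf)
    have "S *v v = s *\<^sub>R v - \<Sigma> *v ?w"
      unfolding S_def matrix_vector_mul_assoc
      by (simp add: matrix_vector_mult_diff_rdistrib scaleR_matrix_vector_assoc[symmetric])
    then show ?thesis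
      unfolding quad neg by (simp only: inner_minus_left inner_minus_right inner_diff_right inner_scaleR_right w)
  qed
  have posS: "0 < v \<bullet> (S *v v)" if "v \<noteq> 0" for v
    using pos[of v "- (transpose A *v v)"] that unfolding resid[symmetric] quad by simp
  obtain B :: "real^'n^'n"
    where B: "\<And>i j. B $ i \<bullet> (S *v (B $ j)) = (if i = j then s else 0)" "(det B)\<^sup>2 * det S = s ^ CARD('n)"
    using positive_definite_whitening[OF symS posS s] by metis
  have detS: "0 < det S" by (rule positive_definite_det_pos[OF symS posS])
  have detB: "det B \<noteq> 0" using B(2) s by auto
  let ?N = "isotropic_normal_density s :: real^'n \<Rightarrow> real"
  \<comment> \<open>The density of the normal law with mean \<open>A (y - \<mu>)\<close> and covariance \<open>S\<close>: the whitened error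
    has covariance \<open>s I\<close>.\<close>
  define q where "q x y = \<bar>det B\<bar> * ?N (B *v (x - A *v (y - \<mu>)))" for x y
  have qm: "(\<lambda>(x, y). q x y) \<in> borel_measurable borel"
  proof -
    have "(\<lambda>z::(real^'n) \<times> (real^'n). B *v (fst z - A *v (snd z - \<mu>))) \<in> borel_measurable borel"
      by (intro borel_measurable_continuous_onI continuous_intros
          continuous_on_compose2[OF matrix_vector_mult_linear_continuous_on[of UNIV]]) auto
    then show ?thesis
      unfolding q_def case_prod_beta by measurable
  qed
  have q_pos: "0 < q x y" for x y
    unfolding q_def using detB by (intro mult_pos_pos isotropic_normal_density_pos s) simp
  have q_int: "(\<integral>\<^sup>+x. ennreal (q x y) \<partial>lborel) = 1" for y
    unfolding q_def by (rule nn_integral_affine_isotropic_normal[OF M X s detB])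
  \<comment> \<open>Each summand is one coordinate of the whitened error, squared and written as a
    combination of \<open>X\<close> and \<open>V\<close> so that \<open>int_sqr\<close> and
    \<open>resid\<close> apply.\<close>
  define T where "T \<omega> = (\<Sum>i\<in>UNIV. (B $ i \<bullet> X \<omega> + (- (transpose A *v (B $ i))) \<bullet> V \<omega>)\<^sup>2)" for \<omega>
  have T: "(norm (B *v (X \<omega> - A *v (Y \<omega> - \<mu>))))\<^sup>2 = T \<omega>" for \<omega>
  proof -
    have "(B *v (X \<omega> - A *v V \<omega>)) $ i = B $ i \<bullet> X \<omega> + (- (transpose A *v (B $ i))) \<bullet> V \<omega>" for i
    proof -
      have "(B *v (X \<omega> - A *v V \<omega>)) $ i = B $ i \<bullet> (X \<omega> - A *v V \<omega>)"
        by (simp add: matrix_vector_mul_component row_def)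
      also have "\<dots> = B $ i \<bullet> X \<omega> - B $ i \<bullet> (A *v V \<omega>)" by (rule inner_diff_right)
      also have "B $ i \<bullet> (A *v V \<omega>) = (transpose A *v (B $ i)) \<bullet> V \<omega>"
        by (metis dot_lmul_matrix transpose_matrix_vector)
      finally show ?thesis by simp
    qed
    then show ?thesis
      unfolding T_def V_def[symmetric] norm_vec_def L2_set_def by (simp add: sum_nonneg)
  qed
  have N2: "(norm (X \<omega>))\<^sup>2 = (\<Sum>i\<in>UNIV. (X \<omega> $ i)\<^sup>2)" for \<omega>
    by (simp add: norm_vec_def L2_set_def sum_nonneg)
  \<comment> \<open>Both normal densities carry the same power of \<open>sqrt (2 * pi * s)\<close>,
    which cancels in the ratio.\<close>
  have L: "ln (q (X \<omega>) (Y \<omega>) / ?N (X \<omega>)) = ln \<bar>det B\<bar> - T \<omega> / (2 * s) + (\<Sum>i\<in>UNIV. (X \<omega> $ i)\<^sup>2) / (2 * s)" for \<omega>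
  proof -
    have "q (X \<omega>) (Y \<omega>) / ?N (X \<omega>) = \<bar>det B\<bar> * (exp (- T \<omega> / (2 * s)) / exp (- (\<Sum>i\<in>UNIV. (X \<omega> $ i)\<^sup>2) / (2 * s)))"
      using s unfolding q_def isotropic_normal_density_def T N2 by (simp add: field_simps)
    then show ?thesis
      using detB by (simp add: ln_mult ln_div)
  qed
  have intT: "integrable M T"
    unfolding T_def by (intro Bochner_Integration.integrable_sum int_sqr)
  have "(\<integral>\<omega>. T \<omega> \<partial>M) = (\<Sum>i\<in>UNIV. B $ i \<bullet> (S *v (B $ i)))"
    unfolding T_def resid[symmetric] by (rule Bochner_Integration.integral_sum) (rule int_sqr)
  \<comment> \<open>Every row of \<open>B\<close> contributes \<open>s\<close>, by the choice of
    scale in the whitening. The squared norm of \<open>X\<close> has the same mean, hence the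
    cancellation.\<close>
  then have expT: "(\<integral>\<omega>. T \<omega> \<partial>M) = real CARD('n) * s"
    by (simp add: B(1))
  have intX: "integrable M (\<lambda>\<omega>. \<Sum>i\<in>UNIV. (X \<omega> $ i)\<^sup>2)" "(\<integral>\<omega>. (\<Sum>i\<in>UNIV. (X \<omega> $ i)\<^sup>2) \<partial>M) = real CARD('n) * s"
    using X2 by auto
  have "ereal (\<integral>\<omega>. ln (q (X \<omega>) (Y \<omega>) / ?N (X \<omega>)) \<partial>M) \<le> mutual_info M X Y"
    by (rule mutual_info_ge_reference[OF M X isotropic_normal_density_pos[OF s] Y ac qm q_pos q_int])
       (use intT expT intX in \<open>simp add: L\<close>)
  also have "(\<integral>\<omega>. ln (q (X \<omega>) (Y \<omega>) / ?N (X \<omega>)) \<partial>M) = ln \<bar>det B\<bar>"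
    unfolding L using intT expT intX by (simp add: prob_space)
  also have "ln \<bar>det B\<bar> = 1/2 * ln (det \<Lambda>) - 1/2 * ln (det (\<Lambda> - (1 / s) *\<^sub>R (transpose \<Sigma> ** \<Sigma>)))"
  proof -
    let ?C = "\<Lambda> - (1 / s) *\<^sub>R (transpose \<Sigma> ** \<Sigma>)"
    \<comment> \<open>The common factor: S = s D, while C is \<Lambda> times the matrix obtained
      from D by exchanging the two factors of its product, which has the same determinant.\<close>
    let ?D = "mat 1 - ((1 / s) *\<^sub>R \<Sigma>) ** transpose A"
    have "s *\<^sub>R (((1 / s) *\<^sub>R \<Sigma>) ** transpose A) = \<Sigma> ** transpose A"
      using s by (simp add: scalar_matrix_assoc)
    then have "S = s *\<^sub>R ?D" by (simp add: S_def scaleR_diff_right)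
    then have dS: "det S = s ^ CARD('n) * det ?D" by (simp add: det_scaleR)
    have "?C = \<Lambda> ** (mat 1 - transpose A ** ((1 / s) *\<^sub>R \<Sigma>))"
      by (simp only: matrix_diff_ldistrib matrix_mul_rid matrix_mul_assoc \<Lambda>A matrix_scalar_ac
          scalar_matrix_assoc[symmetric])
    then have dC: "det ?C = det \<Lambda> * det ?D"
      by (simp only: det_mul det_one_minus_commute[of "transpose A"])
    have "s ^ CARD('n) * ((det B)\<^sup>2 * det ?D) = s ^ CARD('n) * 1"
      using B(2) unfolding dS by (simp only: ac_simps mult_1_right)
    then have "(det B)\<^sup>2 * det ?D = 1" using s by (simp only: mult_cancel_left) simp
    then have "det \<Lambda> * ((det B)\<^sup>2 * det ?D) = det \<Lambda>" by (simp only: mult_1_right)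
    then have prod: "(det B)\<^sup>2 * det ?C = det \<Lambda>" unfolding dC by (simp only: ac_simps)
    have B2: "0 < (det B)\<^sup>2" using detB by simp
    \<comment> \<open>Positivity of \<open>det ?C\<close> is read off the product identity, so that
      the logarithm of the product splits.\<close>
    have "0 < (det B)\<^sup>2 * det ?C" unfolding prod by (rule det\<Lambda>)
    then have "0 < det ?C" using B2 by (rule zero_less_mult_pos)
    then have "ln ((det B)\<^sup>2 * det ?C) = ln ((det B)\<^sup>2) + ln (det ?C)"
      using B2 by (rule ln_mult_pos[rotated])
    then have "ln ((det B)\<^sup>2) + ln (det ?C) = ln (det \<Lambda>)" unfolding prod by (rule sym)
    moreover have "ln ((det B)\<^sup>2) = 2 * ln \<bar>det B\<bar>"
      using detB ln_realpow[of "\<bar>det B\<bar>" 2] by simp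
    ultimately show ?thesis by linarith
  qed
  finally show ?thesis .
qed

section \<open>The joint law of the input and a noisy layer\<close>

text \<open>Open boxes form a generating family closed under intersection. On a box, independence
  factorises the probability and the isotropic density factorises the integral.\<close>

lemma iid_normal_density:
  fixes Z :: "'a \<Rightarrow> real^'n"
  assumes M: "prob_space M" and v: "0 < v" and Z: "iid_normal M v (\<lambda>j \<omega>. Z \<omega> $ j)"
    and Zm [measurable]: "Z \<in> borel_measurable M"
  shows "distr M borel Z = density lborel (\<lambda>x. ennreal (isotropic_normal_density v x))"
proof (rule measure_eqI_generator_eq)
  interpret prob_space M by fact
  let ?E = "range (\<lambda>(a, b). box a b :: (real^'n) set)"
  let ?D = "density lborel (\<lambda>x::real^'n. ennreal (isotropic_normal_density v x))"
  show "Int_stable ?E"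
    by (auto simp: Int_stable_def box_Int_box)
  show "?E \<subseteq> Pow UNIV" "sets (distr M borel Z) = sigma_sets UNIV ?E" "sets ?D = sigma_sets UNIV ?E"
    by (simp_all add: borel_eq_box)
  let ?A = "\<lambda>n::nat. box (- (real n *\<^sub>R One)) (real n *\<^sub>R One) :: (real^'n) set"
  show "range ?A \<subseteq> ?E" "(\<Union>i. ?A i) = UNIV"
    unfolding UN_box_eq_UNIV by auto
  show "emeasure (distr M borel Z) (?A i) \<noteq> \<infinity>" for i
    by (simp add: emeasure_distr)
  fix B assume "B \<in> ?E"
  then obtain l u where B: "B = box l u" by auto
  have Zi [measurable]: "(\<lambda>\<omega>. Z \<omega> $ i) \<in> borel_measurable M" for i
    by (rule measurable_compose[OF Zm borel_measurable_nth])
  have ind: "indep_vars (\<lambda>_. borel) (\<lambda>j \<omega>. Z \<omega> $ j) UNIV"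
    and dis: "distr M borel (\<lambda>\<omega>. Z \<omega> $ j) = density lborel (\<lambda>x. ennreal (normal_density 0 (sqrt v) x))" for j
    using Z v by (auto simp: iid_normal_def centered_normal_def)
  let ?f = "\<lambda>i t. ennreal (normal_density 0 (sqrt v) t) * indicator {l $ i<..<u $ i} t"
  have one: "emeasure M ((\<lambda>\<omega>. Z \<omega> $ i) -` {l $ i<..<u $ i} \<inter> space M) = (\<integral>\<^sup>+t. ?f i t \<partial>lborel)" for i
    using arg_cong[OF dis, of "\<lambda>D. emeasure D {l $ i<..<u $ i}" i]
    by (simp add: emeasure_distr emeasure_density)
  have "Z -` B \<inter> space M = (\<Inter>i\<in>UNIV. (\<lambda>\<omega>. Z \<omega> $ i) -` {l $ i<..<u $ i} \<inter> space M)"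
    by (auto simp: B mem_box_cart)
  then have "emeasure (distr M borel Z) B = ennreal (prob (\<Inter>i\<in>UNIV. (\<lambda>\<omega>. Z \<omega> $ i) -` {l $ i<..<u $ i} \<inter> space M))"
    by (simp add: emeasure_distr B emeasure_eq_measure)
  also have "prob (\<Inter>i\<in>UNIV. (\<lambda>\<omega>. Z \<omega> $ i) -` {l $ i<..<u $ i} \<inter> space M)
      = (\<Prod>i\<in>UNIV. prob ((\<lambda>\<omega>. Z \<omega> $ i) -` {l $ i<..<u $ i} \<inter> space M))"
    by (rule indep_varsD[OF ind]) auto
  also have "ennreal \<dots> = (\<Prod>i\<in>UNIV. emeasure M ((\<lambda>\<omega>. Z \<omega> $ i) -` {l $ i<..<u $ i} \<inter> space M))"
    by (simp add: emeasure_eq_measure prod_ennreal)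
  also have "\<dots> = (\<Prod>b\<in>(Basis :: (real^'n) set). \<integral>\<^sup>+t. ?f (axis_index b) t \<partial>lborel)"
    unfolding one prod_Basis_vec by (simp add: axis_index_axis)
  also have "\<dots> = (\<integral>\<^sup>+x. (\<Prod>b\<in>Basis. ?f (axis_index b) (x \<bullet> b)) \<partial>(lborel :: (real^'n) measure))"
    by (rule nn_integral_lborel_prod[symmetric]) auto
  also have "\<dots> = (\<integral>\<^sup>+x. ennreal (isotropic_normal_density v x) * indicator B x \<partial>lborel)"
  proof (rule nn_integral_cong)
    fix x :: "real^'n"
    have "(\<Prod>b\<in>Basis. indicator {l $ axis_index b<..<u $ axis_index b} (x \<bullet> b)) = (indicator B x :: ennreal)"
      unfolding prod_Basis_vec B
      by (auto simp: axis_index_axis inner_axis mem_box_cart indicator_def intro!: prod_zero)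
    then show "(\<Prod>b\<in>Basis. ?f (axis_index b) (x \<bullet> b)) = ennreal (isotropic_normal_density v x) * indicator B x"
      unfolding prod.distrib by (simp add: isotropic_normal_density_prod[OF v] prod_ennreal)
  qed
  also have "\<dots> = emeasure ?D B"
    by (rule emeasure_density[symmetric]) (auto simp: B)
  finally show "emeasure (distr M borel Z) B = emeasure ?D B" .
qed

text \<open>Conditionally on \<open>(X, G)\<close>, the sum \<open>G + N\<close> is a translate of \<open>N\<close>, and translation preserves null
  sets.\<close>

lemma absolutely_continuous_add_independent:
  fixes X :: "'a \<Rightarrow> 'b::euclidean_space" and G N :: "'a \<Rightarrow> 'c::euclidean_space"
  assumes M: "prob_space M"
    and X: "absolutely_continuous lborel (distr M borel X)" and N: "absolutely_continuous lborel (distr M borel N)"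
    and Xm [measurable]: "X \<in> borel_measurable M" and Gm [measurable]: "G \<in> borel_measurable M"
    and Nm [measurable]: "N \<in> borel_measurable M"
    and ind: "prob_space.indep_set M {(\<lambda>\<omega>. (X \<omega>, G \<omega>)) -` A \<inter> space M |A. A \<in> sets (borel \<Otimes>\<^sub>M borel)}
      {N -` A \<inter> space M |A. A \<in> sets borel}"
  shows "absolutely_continuous (lborel \<Otimes>\<^sub>M lborel) (distr M (lborel \<Otimes>\<^sub>M lborel) (\<lambda>\<omega>. (X \<omega>, G \<omega> + N \<omega>)))"
  unfolding absolutely_continuous_def
proof
  interpret prob_space M by fact
  fix A assume A: "A \<in> null_sets (lborel \<Otimes>\<^sub>M lborel :: ('b \<times> 'c) measure)"
  then have As [measurable]: "A \<in> sets (borel \<Otimes>\<^sub>M borel)"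
    by (auto simp: null_sets_def cong: sets_pair_measure_cong)
  let ?D1 = "distr M (borel \<Otimes>\<^sub>M borel) (\<lambda>\<omega>. (X \<omega>, G \<omega>))" and ?D2 = "distr M borel N"
  interpret D1: prob_space ?D1 by (rule prob_space_distr) simp
  interpret D2: prob_space ?D2 by (rule prob_space_distr) simp
  have prod: "?D1 \<Otimes>\<^sub>M ?D2 = distr M ((borel \<Otimes>\<^sub>M borel) \<Otimes>\<^sub>M borel) (\<lambda>\<omega>. ((X \<omega>, G \<omega>), N \<omega>))"
  proof (rule pair_measure_eqI)
    fix U V assume "U \<in> sets ?D1" "V \<in> sets ?D2"
    then have [measurable]: "U \<in> sets (borel \<Otimes>\<^sub>M borel)" "V \<in> sets borel" by simp_all
    have "(\<lambda>\<omega>. ((X \<omega>, G \<omega>), N \<omega>)) -` (U \<times> V) \<inter> space M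
        = ((\<lambda>\<omega>. (X \<omega>, G \<omega>)) -` U \<inter> space M) \<inter> (N -` V \<inter> space M)" by auto
    moreover have "prob \<dots> = prob ((\<lambda>\<omega>. (X \<omega>, G \<omega>)) -` U \<inter> space M) * prob (N -` V \<inter> space M)"
      by (rule indep_setD[OF ind]) auto
    ultimately show "emeasure ?D1 U * emeasure ?D2 V
        = emeasure (distr M ((borel \<Otimes>\<^sub>M borel) \<Otimes>\<^sub>M borel) (\<lambda>\<omega>. ((X \<omega>, G \<omega>), N \<omega>))) (U \<times> V)"
      by (simp add: emeasure_distr emeasure_eq_measure ennreal_mult)
  qed (auto simp: D1.sigma_finite_measure_axioms D2.sigma_finite_measure_axioms cong: sets_pair_measure_cong)
  \<comment> \<open>The event \<open>A\<close> pulled back to the triple ((X, G), N). By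
    \<open>prod\<close> its probability is the integral over the law of (X, G) of the mass that the
    law of \<open>N\<close> gives to a section.\<close>
  let ?B = "{z \<in> space ((borel \<Otimes>\<^sub>M borel) \<Otimes>\<^sub>M borel). (fst (fst z), snd (fst z) + snd z) \<in> A}"
  have Bm [measurable]: "?B \<in> sets ((borel \<Otimes>\<^sub>M borel) \<Otimes>\<^sub>M borel)" by measurable
  \<comment> \<open>By Tonelli almost every section of \<open>A\<close> is null. Absolute continuity
    of the law of \<open>X\<close> carries this from Lebesgue-almost every x to almost every
    \<open>X \<omega>\<close>.\<close>
  have "AE x in lborel. emeasure lborel (Pair x -` A) = 0"
  proof -
    have "(\<integral>\<^sup>+x. emeasure lborel (Pair x -` A) \<partial>lborel) = 0"
      using A lborel.emeasure_pair_measure_alt[of A lborel] by (auto simp: null_sets_def)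
    then show ?thesis
      using A by (subst (asm) nn_integral_0_iff_AE) (auto intro!: lborel.measurable_emeasure_Pair)
  qed
  then have "AE x in distr M borel X. emeasure lborel (Pair x -` A) = 0"
    by (rule absolutely_continuous_AE[OF _ X, rotated]) simp
  then have "AE \<omega> in M. emeasure lborel (Pair (X \<omega>) -` A) = 0"
    by (rule AE_distrD[OF Xm])
  then have "AE \<omega> in M. emeasure ?D2 (Pair (X \<omega>, G \<omega>) -` ?B) = 0"
  proof eventually_elim
    fix \<omega> assume 0: "emeasure lborel (Pair (X \<omega>) -` A) = 0"
    let ?C = "Pair (X \<omega>) -` A"
    have C [measurable]: "?C \<in> sets borel" using sets_Pair1[OF As, of "X \<omega>"] by simp
    have eq: "Pair (X \<omega>, G \<omega>) -` ?B = (+) (G \<omega>) -` ?C" by (auto simp: space_pair_measure)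
    have "emeasure lborel ((+) (G \<omega>) -` ?C) = emeasure (distr lborel borel ((+) (G \<omega>))) ?C"
      by (simp add: emeasure_distr)
    also have "\<dots> = 0" using 0 by (simp add: lborel_distr_plus)
    finally have "(+) (G \<omega>) -` ?C \<in> null_sets lborel"
      using measurable_sets[of "(+) (G \<omega>)" borel borel ?C] by (simp add: null_sets_def)
    then show "emeasure ?D2 (Pair (X \<omega>, G \<omega>) -` ?B) = 0"
      unfolding eq using N by (auto simp: absolutely_continuous_def null_sets_def)
  qed
  then have "(\<integral>\<^sup>+\<omega>. emeasure ?D2 (Pair (X \<omega>, G \<omega>) -` ?B) \<partial>M) = 0"
    by (subst nn_integral_cong_AE[where v = "\<lambda>_. 0"]) auto
  also have "(\<integral>\<^sup>+\<omega>. emeasure ?D2 (Pair (X \<omega>, G \<omega>) -` ?B) \<partial>M) = (\<integral>\<^sup>+z. emeasure ?D2 (Pair z -` ?B) \<partial>?D1)"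
    by (rule nn_integral_distr[symmetric]) (auto intro!: D2.measurable_emeasure_Pair simp: Bm)
  also have "\<dots> = emeasure (?D1 \<Otimes>\<^sub>M ?D2) ?B"
    by (rule D2.emeasure_pair_measure_alt[symmetric]) (use Bm in \<open>simp cong: sets_pair_measure_cong\<close>)
  also have "\<dots> = emeasure M ((\<lambda>\<omega>. ((X \<omega>, G \<omega>), N \<omega>)) -` ?B \<inter> space M)"
    unfolding prod by (rule emeasure_distr[OF _ Bm]) measurable
  also have "(\<lambda>\<omega>. ((X \<omega>, G \<omega>), N \<omega>)) -` ?B \<inter> space M = (\<lambda>\<omega>. (X \<omega>, G \<omega> + N \<omega>)) -` A \<inter> space M"
    by (auto simp: space_pair_measure)
  also have "emeasure M \<dots> = emeasure (distr M (lborel \<Otimes>\<^sub>M lborel) (\<lambda>\<omega>. (X \<omega>, G \<omega> + N \<omega>))) A"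
    by (rule emeasure_distr[symmetric, OF _ null_setsD2[OF A]]) measurable
  finally show "A \<in> null_sets (distr M (lborel \<Otimes>\<^sub>M lborel) (\<lambda>\<omega>. (X \<omega>, G \<omega> + N \<omega>)))"
    using A by (auto simp: null_sets_def)
qed

section \<open>Measurability of the layers and independence of the last noise\<close>

lemma borel_measurable_vec_lambda:
  fixes f :: "'n::finite \<Rightarrow> 'a \<Rightarrow> real"
  assumes "\<And>j. f j \<in> borel_measurable M"
  shows "(\<lambda>\<omega>. \<chi> j. f j \<omega>) \<in> borel_measurable M"
proof -
  have "(\<lambda>\<omega>. \<chi> j. f j \<omega>) = (\<lambda>\<omega>. \<Sum>j\<in>UNIV. f j \<omega> *\<^sub>R axis j 1)"
    by (auto simp: vec_eq_iff axis_def if_distrib fun_eq_iff cong: if_cong)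
  then show ?thesis using assms by simp
qed

lemma borel_measurable_map_vec:
  fixes h :: "'a \<Rightarrow> real^'n" and \<phi> :: "real \<Rightarrow> real"
  assumes \<phi>: "\<phi> \<in> borel_measurable borel" and h: "h \<in> borel_measurable F"
  shows "(\<lambda>\<omega>. \<chi> j. \<phi> (h \<omega> $ j)) \<in> borel_measurable F"
  by (intro borel_measurable_vec_lambda measurable_compose[OF _ \<phi>]
      measurable_compose[OF h borel_measurable_nth])

text \<open>\<open>F\<close> is left general because it will be the sigma-algebra generated by the
  input and the noises before the last layer, not only \<open>M\<close>.\<close>

lemma hidden_measurable:
  assumes \<phi> [measurable]: "\<phi> \<in> borel_measurable borel" and X [measurable]: "X \<in> borel_measurable F"
    and N: "\<And>k. 1 \<le> k \<Longrightarrow> k \<le> i \<Longrightarrow> N k \<in> borel_measurable F"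
  shows "(\<lambda>\<omega>. hidden \<phi> w b (X \<omega>) (\<lambda>k. N k \<omega>) i) \<in> borel_measurable F"
  using N
proof (induction i rule: induct_nat_012)
  case 0
  then show ?case by simp
next
  case 1
  then have [measurable]: "N (Suc 0) \<in> borel_measurable F" by simp
  show ?case by simp
next
  case (ge2 i)
  then have [measurable]: "N (Suc (Suc i)) \<in> borel_measurable F" by simp
  have h [measurable]: "(\<lambda>\<omega>. hidden \<phi> w b (X \<omega>) (\<lambda>k. N k \<omega>) (Suc i)) \<in> borel_measurable F"
    using ge2 by simp
  have [measurable]: "(\<lambda>\<omega>. \<chi> j. \<phi> (hidden \<phi> w b (X \<omega>) (\<lambda>k. N k \<omega>) (Suc i) $ j)) \<in> borel_measurable F"
    by (rule borel_measurable_map_vec[OF \<phi> h])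
  show ?case by simp
qed

text \<open>Only noises with index strictly below \<open>l\<close> enter \<open>G\<close>. Its
  measurability for \<open>F\<close> will yield independence of (X, G) from the last noise.\<close>

lemma frozen_decomposition:
  assumes l: "1 \<le> l" and \<phi> [measurable]: "\<phi> \<in> borel_measurable borel" and X [measurable]: "X \<in> borel_measurable F"
    and N: "\<And>k. 1 \<le> k \<Longrightarrow> k < l \<Longrightarrow> N k \<in> borel_measurable F"
  obtains G where "G \<in> borel_measurable F" "\<And>\<omega>. frozen \<phi> l X N w b \<omega> = G \<omega> + N l \<omega>"
proof (cases "l = 1")
  case True
  show ?thesis
  proof (rule that)
    show "(\<lambda>\<omega>. w 1 *v X \<omega> + b 1) \<in> borel_measurable F" by measurable
  qed (simp add: True frozen_def)
next
  case False
  then have "l = Suc (Suc (l - 2))" using l by simp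
  then obtain i where i: "l = Suc (Suc i)" by blast
  have h [measurable]: "(\<lambda>\<omega>. hidden \<phi> w b (X \<omega>) (\<lambda>k. N k \<omega>) (Suc i)) \<in> borel_measurable F"
    by (rule hidden_measurable) (use N i in auto)
  have [measurable]: "(\<lambda>\<omega>. \<chi> j. \<phi> (hidden \<phi> w b (X \<omega>) (\<lambda>k. N k \<omega>) (Suc i) $ j)) \<in> borel_measurable F"
    by (rule borel_measurable_map_vec[OF \<phi> h])
  show ?thesis
  proof (rule that)
    show "(\<lambda>\<omega>. w l *v (\<chi> j. \<phi> (hidden \<phi> w b (X \<omega>) (\<lambda>k. N k \<omega>) (Suc i) $ j)) + b l) \<in> borel_measurable F"
      by measurable
  qed (simp add: i frozen_def)
qed

lemma Int_stable_generated_events: "Int_stable (generated_events M Z)"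
  unfolding Int_stable_def generated_events_def
proof safe
  fix A B :: "'b set" assume "A \<in> sets borel" "B \<in> sets borel"
  then show "\<exists>C. Z -` A \<inter> space M \<inter> (Z -` B \<inter> space M) = Z -` C \<inter> space M \<and> C \<in> sets borel"
    by (intro exI[of _ "A \<inter> B"]) auto
qed

text \<open>The weights \<open>w\<close> and biases \<open>c\<close> are arbitrary constants, so the
  conclusion holds at every value of the random weights. The remaining sources form two independent
  blocks: the last noise, and whatever feeds \<open>G\<close>.\<close>

lemma frozen_absolutely_continuous:
  fixes X :: "'a \<Rightarrow> real^'n"
  assumes M: "prob_space M" and l: "1 \<le> l" and \<phi>: "\<phi> \<in> borel_measurable borel"
    and X: "absolutely_continuous lborel (distr M borel X)" and Xm [measurable]: "X \<in> borel_measurable M"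
    and v: "0 < v" and N: "iid_normal M v (\<lambda>j \<omega>. N l \<omega> $ j)"
    and ind: "mutually_independent M l X W b N"
  shows "frozen \<phi> l X N w c \<in> borel_measurable M"
    and "absolutely_continuous (lborel \<Otimes>\<^sub>M lborel)
      (distr M (lborel \<Otimes>\<^sub>M lborel) (\<lambda>\<omega>. (X \<omega>, frozen \<phi> l X N w c \<omega>)))"
proof -
  interpret prob_space M by fact
  let ?E = "\<lambda>s. case s of Input \<Rightarrow> generated_events M X | Weight i \<Rightarrow> generated_events M (W i)
    | Bias i \<Rightarrow> generated_events M (b i) | Noise i \<Rightarrow> generated_events M (N i)"
  \<comment> \<open>The blocks are indexed by \<open>bool\<close> because \<open>indep_set\<close>
    is independence of a family over \<open>bool\<close>, its first argument at
    \<open>True\<close>.\<close>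
  define K where "K t = (if t then insert Input (Noise ` {1..<l}) else {Noise l})" for t
  define F where "F = sigma (space M) (\<Union>s\<in>K True. ?E s)"
  have sub: "(\<Union>t. K t) \<subseteq> {Input} \<union> Weight ` {1..l} \<union> Bias ` {1..l} \<union> Noise ` {1..l}"
    using l by (auto simp: K_def split: if_splits)
  have indE: "indep_sets ?E (\<Union>t. K t)"
    using ind unfolding mutually_independent_def by (rule indep_sets_mono_index[OF sub])
  have indF: "indep_sets (\<lambda>t. sigma_sets (space M) (\<Union>s\<in>K t. ?E s)) UNIV"
  proof (rule indep_sets_collect_sigma[OF indE])
    show "disjoint_family_on K UNIV" by (auto simp: disjoint_family_on_def K_def split: if_splits)
  qed (auto simp: Int_stable_generated_events split: source.split)
  have E_pow: "(\<Union>s\<in>J. ?E s) \<subseteq> Pow (space M)" for J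
    by (auto simp: generated_events_def split: source.splits)
  have setsF: "sets F = sigma_sets (space M) (\<Union>s\<in>K True. ?E s)"
    unfolding F_def by (rule sets_measure_of[OF E_pow])
  have spaceF: "space F = space M" unfolding F_def by (rule space_measure_of[OF E_pow])
  have E_events: "?E s \<subseteq> events" if "s \<in> (\<Union>t. K t)" for s
    using indE that by (auto simp: indep_sets_def)
  have subF: "sets F \<subseteq> events"
    unfolding setsF using E_events by (intro sets.sigma_sets_subset) blast
  have FM: "g \<in> measurable M L" if "g \<in> measurable F L" for g :: "'a \<Rightarrow> 'z" and L
    using that subF spaceF by (auto simp: measurable_def)
  have gen: "Z \<in> borel_measurable F" if "generated_events M Z \<subseteq> (\<Union>s\<in>K True. ?E s)" for Z :: "'a \<Rightarrow> real^'n"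
  proof (rule measurableI)
    fix A :: "(real^'n) set" assume "A \<in> sets borel"
    then have "Z -` A \<inter> space M \<in> (\<Union>s\<in>K True. ?E s)" using that by (auto simp: generated_events_def)
    then show "Z -` A \<inter> space F \<in> sets F" unfolding setsF spaceF by (rule sigma_sets.Basic)
  qed simp
  have XF: "X \<in> borel_measurable F" by (rule gen) (force simp: K_def)
  have NF: "N k \<in> borel_measurable F" if "1 \<le> k" "k < l" for k
  proof (rule gen)
    have "Noise k \<in> K True" using that by (auto simp: K_def)
    then show "generated_events M (N k) \<subseteq> (\<Union>s\<in>K True. ?E s)" by force
  qed
  \<comment> \<open>Measurability is contained in independence: \<open>indep_sets\<close> asserts
    that all sets of its families are events.\<close>
  have Nl: "N l \<in> borel_measurable M"
  proof (rule measurableI)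
    fix A :: "(real^'n) set" assume "A \<in> sets borel"
    then have "N l -` A \<inter> space M \<in> ?E (Noise l)" by (auto simp: generated_events_def)
    moreover have "?E (Noise l) \<subseteq> events" by (rule E_events) (auto simp: K_def intro!: exI[of _ False])
    ultimately show "N l -` A \<inter> space M \<in> events" by blast
  qed simp
  obtain G where G: "G \<in> borel_measurable F" and fr: "\<And>\<omega>. frozen \<phi> l X N w c \<omega> = G \<omega> + N l \<omega>"
    by (rule frozen_decomposition[OF l \<phi> XF NF, where w = w and b = c]) (assumption, assumption, rule that)
  have Gm [measurable]: "G \<in> borel_measurable M" by (rule FM[OF G])
  show "frozen \<phi> l X N w c \<in> borel_measurable M"
    unfolding ext[of "frozen \<phi> l X N w c", OF fr] using Gm Nl by (rule borel_measurable_add)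
  have XG: "(\<lambda>\<omega>. (X \<omega>, G \<omega>)) \<in> measurable F (borel \<Otimes>\<^sub>M borel)"
    using XF G by measurable
  have "indep_set {(\<lambda>\<omega>. (X \<omega>, G \<omega>)) -` A \<inter> space M |A. A \<in> sets (borel \<Otimes>\<^sub>M borel)}
      {N l -` A \<inter> space M |A. A \<in> sets borel}"
    unfolding indep_set_def
  proof (rule indep_sets_mono_sets[OF indF])
    fix t :: bool
    have "{(\<lambda>\<omega>. (X \<omega>, G \<omega>)) -` A \<inter> space M |A. A \<in> sets (borel \<Otimes>\<^sub>M borel)} \<subseteq> sigma_sets (space M) (\<Union>s\<in>K True. ?E s)"
      using measurable_sets[OF XG] unfolding setsF spaceF by auto
    moreover have "{N l -` A \<inter> space M |A. A \<in> sets borel} \<subseteq> (\<Union>s\<in>K False. ?E s)"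
      by (auto simp: K_def generated_events_def)
    then have "{N l -` A \<inter> space M |A. A \<in> sets borel} \<subseteq> sigma_sets (space M) (\<Union>s\<in>K False. ?E s)"
      by (meson sigma_sets_superset_generator subset_trans)
    ultimately show "(case t of True \<Rightarrow> {(\<lambda>\<omega>. (X \<omega>, G \<omega>)) -` A \<inter> space M |A. A \<in> sets (borel \<Otimes>\<^sub>M borel)}
        | False \<Rightarrow> {N l -` A \<inter> space M |A. A \<in> sets borel})
      \<subseteq> sigma_sets (space M) (\<Union>s\<in>K t. ?E s)"
      by (cases t) simp_all
  qed
  moreover have "absolutely_continuous lborel (distr M borel (N l))"
    unfolding iid_normal_density[OF M v N Nl] by (rule absolutely_continuousI_density) measurable
  ultimately show "absolutely_continuous (lborel \<Otimes>\<^sub>M lborel)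
      (distr M (lborel \<Otimes>\<^sub>M lborel) (\<lambda>\<omega>. (X \<omega>, frozen \<phi> l X N w c \<omega>)))"
    unfolding fr by (intro absolutely_continuous_add_independent[OF M X _ Xm Gm Nl])
qed

section \<open>Averaging over the weights\<close>

theorem mainTheorem2:
  fixes M :: "'a measure" and \<phi> :: "real \<Rightarrow> real" and l :: nat
    and \<sigma>x \<sigma>w \<sigma>b \<sigma>n :: real
    and X :: "'a \<Rightarrow> real^'n::finite"
    and W :: "nat \<Rightarrow> 'a \<Rightarrow> real^'n^'n"
    and b N :: "nat \<Rightarrow> 'a \<Rightarrow> real^'n"
  defines "\<Lambda> \<equiv> \<lambda>\<omega>. cond_Lambda M \<phi> l X N (\<lambda>i. W i \<omega>) (\<lambda>i. b i \<omega>)"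
    and "\<Sigma> \<equiv> \<lambda>\<omega>. cond_Sigma M \<phi> l X N (\<lambda>i. W i \<omega>) (\<lambda>i. b i \<omega>)"
  assumes "prob_space M"
    and "l \<ge> 1" and "\<sigma>x > 0" and "\<sigma>n > 0" and "\<sigma>w > 0" and "\<sigma>b \<ge> 0"
    and "\<phi> \<in> borel_measurable borel"
    and "distributed M lborel X (\<lambda>x. ennreal (isotropic_normal_density (\<sigma>x\<^sup>2) x))"
    and "\<And>i. i \<in> {1..l} \<Longrightarrow>
           iid_normal M (\<sigma>w\<^sup>2 / real CARD('n)) (\<lambda>(j, k) \<omega>. W i \<omega> $ j $ k)"
    and "\<And>i. i \<in> {1..l} \<Longrightarrow> iid_normal M (\<sigma>b\<^sup>2) (\<lambda>j \<omega>. b i \<omega> $ j)"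
    and "\<And>i. i \<in> {1..l} \<Longrightarrow> iid_normal M (\<sigma>n\<^sup>2) (\<lambda>j \<omega>. N i \<omega> $ j)"
    and "mutually_independent M l X W b N"
    and "AE \<omega> in M. \<forall>j.
           integrable M (\<lambda>\<omega>'. (frozen \<phi> l X N (\<lambda>i. W i \<omega>) (\<lambda>i. b i \<omega>) \<omega>' $ j)\<^sup>2)"
    and "integrable M (\<lambda>\<omega>. ln (det (\<Lambda> \<omega>)))"
    and "integrable M (\<lambda>\<omega>. 1/2 * ln (det (\<Lambda> \<omega> - (1 / \<sigma>x\<^sup>2) *\<^sub>R (transpose (\<Sigma> \<omega>) ** \<Sigma> \<omega>))))"
  shows "network_mutual_info M \<phi> l X W b N \<ge>
    ereal (1/2 * (\<integral>\<omega>. ln (det (\<Lambda> \<omega>)) \<partial>M)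
         - (\<integral>\<omega>. 1/2 * ln (det (\<Lambda> \<omega> - (1 / \<sigma>x\<^sup>2) *\<^sub>R (transpose (\<Sigma> \<omega>) ** \<Sigma> \<omega>))) \<partial>M))"
proof -
  note l = assms(4) and \<sigma>x = assms(5) and \<sigma>n = assms(6) and X = assms(10)
  have s: "0 < \<sigma>x\<^sup>2" and v: "0 < \<sigma>n\<^sup>2" using \<sigma>x \<sigma>n by simp_all
  have Xm: "X \<in> borel_measurable M" by (rule isotropic_normal_measurable[OF assms(3) s X])
  have "distr M borel X = density lborel (\<lambda>x. ennreal (isotropic_normal_density (\<sigma>x\<^sup>2) x))"
    using distributed_distr_eq_density[OF X] by (metis distr_cong sets_lborel)
  moreover have "absolutely_continuous lborel (density lborel (\<lambda>x::real^'n. ennreal (isotropic_normal_density (\<sigma>x\<^sup>2) x)))"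
    by (rule absolutely_continuousI_density) measurable
  ultimately have Xac: "absolutely_continuous lborel (distr M borel X)" by simp
  have N: "iid_normal M (\<sigma>n\<^sup>2) (\<lambda>j \<omega>. N l \<omega> $ j)" by (rule assms(13)) (use l in simp)
  note frozen = frozen_absolutely_continuous[OF assms(3) l assms(9) Xac Xm v N assms(14)]
  let ?h = "\<lambda>\<omega>. 1/2 * ln (det (\<Lambda> \<omega> - (1 / \<sigma>x\<^sup>2) *\<^sub>R (transpose (\<Sigma> \<omega>) ** \<Sigma> \<omega>)))"
  \<comment> \<open>The outer \<open>\<omega>\<close> only selects constants for the weights and
    biases; the moments and the mutual information integrate over a separate copy of the sample
    space.\<close>
  have "AE \<omega> in M. ereal (1/2 * ln (det (\<Lambda> \<omega>)) - ?h \<omega>)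
      \<le> mutual_info M X (frozen \<phi> l X N (\<lambda>i. W i \<omega>) (\<lambda>i. b i \<omega>))"
    using assms(15)
  proof eventually_elim
    case (elim \<omega>)
    show ?case
      unfolding \<Lambda>_def \<Sigma>_def cond_Lambda_def cond_Sigma_def
      by (rule mutual_info_gaussian_bound[OF assms(3) s X frozen(1) _ frozen(2)]) (use elim in blast)
  qed
  then have "ereal (\<integral>\<omega>. 1/2 * ln (det (\<Lambda> \<omega>)) - ?h \<omega> \<partial>M) \<le> network_mutual_info M \<phi> l X W b N"
    unfolding network_mutual_info_def
    by (intro quasi_integral_ge Bochner_Integration.integrable_diff integrable_mult_right assms(16,17))
  moreover have "(\<integral>\<omega>. 1/2 * ln (det (\<Lambda> \<omega>)) - ?h \<omega> \<partial>M) = 1/2 * (\<integral>\<omega>. ln (det (\<Lambda> \<omega>)) \<partial>M) - (\<integral>\<omega>. ?h \<omega> \<partial>M)"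
    using Bochner_Integration.integral_diff[OF integrable_mult_right[OF assms(16), of "1/2"] assms(17)]
    by (simp only: integral_mult_right_zero)
  ultimately show ?thesis by simp
qed

end
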